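(* Assume $\mu_1,\mu_2,\lambda,\tau>0$, $0<c_{\mathrm{pm}}^{\mathrm{so}}<c_{\mathrm{pm}}^{\mathrm{uso}}<c_{\mathrm{cm}}$ and $p\in(0,1)$ (i.e. the imperfect preventive maintenance probability $1-p$ is positive). Then the optimal policy under the average cost criterion is the following. (a) For condition $2$: do nothing (in all states $(2,\mathrm{USO},t)$, $t\in(0,\tau)$, and $(2,\mathrm{SO},0)$). (b) For condition $1$ at a scheduled opportunity, i.e. in state $(1,\mathrm{SO},0)$: perform preventive maintenance if $$\mu_1 c_{\mathrm{cm}} > (\mu_1+\mu_2)\frac{c_{\mathrm{pm}}^{\mathrm{so}}}{p},$$ and do nothing otherwise. (c) For condition $1$ at an unscheduled opportunity, i.e. in states $(1,\mathrm{USO},t)$, $t\in(0,\tau)$: if $$\mu_1 c_{\mathrm{cm}} > \left( \frac{c_{\mathrm{pm}}^{\mathrm{uso}}}{p} - \frac{c_{\mathrm{pm}}^{\mathrm{uso}} - c_{\mathrm{pm}}^{\mathrm{so}}}{e^{(\mu_1 +\mu_2)\tau}-1} \right) (\mu_1+\mu_2),$$ perform preventive maintenance at those unscheduled opportunities for which the residual time $t$ until the next scheduled opportunity lies in $[\hat t,\tau)$; do nothing otherwise. Here $\hat t=\min\{\tau,\max\{0,t^*\}\}$, with $t^*$ satisfying $$\frac{c_{\mathrm{pm}}^{\mathrm{uso}}}{p} = \frac{\mu_1c_{\mathrm{cm}} + \lambda c_{\mathrm{pm}}^{\mathrm{uso} }}{\mu_1+\mu_2 + \lambda p } + \left(\frac{-c_{\mathrm{pm}}^{\mathrm{so}}+\frac{\mu_1c_{\mathrm{cm}}}{\mu_1+\mu_2}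 + \left( \frac{c_{\mathrm{pm}}^{\mathrm{uso}}}{p} - \frac{\mu_1 c_{\mathrm{cm}}}{\mu_1 + \mu_2} \right) e^{(\mu_1+\mu_2)t^*}}{1-p} -\frac{\mu_1c_{\mathrm{cm}} + \lambda c_{\mathrm{pm}}^{\mathrm{uso} }}{\mu_1+\mu_2 + \lambda p } \right) e^{(\mu_1+\mu_2 + \lambda p )(\tau-t^* )}.$$
   Context: Model. A single-unit system has condition $2$ (perfect) or $1$ (satisfactory). It spends an $\mathrm{Exp}(\mu_i)$ time in condition $i\in\{1,2\}$. From condition $2$ it moves to condition $1$; when the time in condition $1$ expires the system fails and is instantaneously replaced (corrective maintenance, CM, cost $c_{\mathrm{cm}}$), returning to condition $2$. Scheduled opportunities (SO) for preventive maintenance (PM) occur at times $\tau,2\tau,3\tau,\dots$; unscheduled opportunities (USO) occur according to an independent Poisson process of rate $\lambda$. PM costs $c_{\mathrm{pm}}^{\mathrm{so}}$ at an SO and $c_{\mathrm{pm}}^{\mathrm{uso}}$ at a USO. After PM the system is "as good as new" (condition $2$) with probability $p$ and "as bad as old" (unchanged) with probability $q=1-p$, independently of everything else. Semi-Markov decision process. The state space is $$\mathcal S=\{(i,j,t): i\in\{1,2\},\ j\in\{\mathrm{SC},\mathrm{USO}\},\ t\in(0,\tau)\}\cup\{(i,\mathrm{SO},0): i\in\{1,2\}\},$$ where $i$ is the condition, $j$ the type of epoch (SC = the condition is about to change) and $t$ the remaining time until the next SO. Admissible actions $\mathcal A_x$: in $(2,\mathrm{SC},t)$ only "do nothing"; in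 $(1,\mathrm{SC},t)$ only "perform CM"; in $(i,\mathrm{USO},t)$ and $(i,\mathrm{SO},0)$ either "perform PM" or "do nothing". Immediate costs $c(x;a)$: $0$ for "do nothing", $c_{\mathrm{cm}}$ for CM, $c_{\mathrm{pm}}^{\mathrm{uso}}$ for PM at a USO, $c_{\mathrm{pm}}^{\mathrm{so}}$ for PM at an SO. Dynamics: after the action the condition is $k$, where $k=1$ from $(2,\mathrm{SC},t)$; $k=2$ from $(1,\mathrm{SC},t)$; $k=i$ from $(i,\mathrm{USO},t)$ or $(i,\mathrm{SO},0)$ under "do nothing"; and $k=2$ with probability $p$, $k=i$ with probability $1-p$, under "perform PM". Put $r=t$ for SC and USO states and $r=\tau$ for SO states. The next transition time and state then have density $\mu_k e^{-(\lambda+\mu_k)s}$ at $(s,(k,\mathrm{SC},r-s))$ and density $\lambda e^{-(\lambda+\mu_k)s}$ at $(s,(k,\mathrm{USO},r-s))$ for $0<s<r$, and an atom of mass $e^{-(\lambda+\mu_k)r}$ at $(r,(k,\mathrm{SO},0))$. Average cost criterion. Let $X_k,A_k$ be the state and action at the $k$-th transition epoch $T_k$, $T_0=0$. For a policy $\pi$ and initial state $x$, $$J(x,\pi)=\limsup_{n\to\infty}\frac{\mathbb E_x^\pi\left[\sum_{k=0}^{n-1}c(X_k;A_k)\right]}{\mathbb E_x^\pi[T_n]}.$$ A deterministic stationary policy is optimal if it attains $\inf_\pi J(x,\pi)$ over deterministic stationary policies for every $x\in\mathcal S$.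
   Formalization: The equation for t* may have no solution or several when the condition in (c) holds; the formal theorem says that some solution t* gives the optimal policy if one exists, and that doing nothing at all unscheduled opportunities is optimal if none exists. *)

theory Defs
  imports "HOL-Probability.Probability"
begin

datatype condition = Satisfactory | Perfect   (* conditions 1 and 2 *)

datatype epoch = SC | USO | SO

datatype action = DoNothing | PM | CM

type_synonym state = "condition \<times> epoch \<times> real"

type_synonym policy = "state \<Rightarrow> action"

record model =
  mu1 :: real
  mu2 :: real
  uso_rate :: real
  tau :: real
  pr :: real       (* success probability p of preventive maintenance *)
  cost_so :: real
  cost_uso :: real
  cost_cm :: real

fun rate :: "model \<Rightarrow> condition \<Rightarrow> real" where
  "rate m Satisfactory = mu1 m"
| "rate m Perfect = mu2 m"

definition state_space :: "model \<Rightarrow> state set" where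
  "state_space m =
     {(i, j, t). j \<in> {SC, USO} \<and> 0 < t \<and> t < tau m} \<union> {(i, j, t). j = SO \<and> t = 0}"

fun admissible :: "state \<Rightarrow> action set" where
  "admissible (Perfect, SC, t) = {DoNothing}"
| "admissible (Satisfactory, SC, t) = {CM}"
| "admissible (i, USO, t) = {PM, DoNothing}"
| "admissible (i, SO, t) = {PM, DoNothing}"

text \<open>The values of \<open>cost\<close> and \<open>after\<close> at inadmissible state-action pairs are irrelevant.\<close>

fun cost :: "model \<Rightarrow> state \<Rightarrow> action \<Rightarrow> real" where
  "cost m x DoNothing = 0"
| "cost m x CM = cost_cm m"
| "cost m (i, j, t) PM = (if j = USO then cost_uso m else cost_so m)"

fun after :: "model \<Rightarrow> state \<Rightarrow> action \<Rightarrow> condition pmf" where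
  "after m (Perfect, SC, t) a = return_pmf Satisfactory"
| "after m (Satisfactory, SC, t) a = return_pmf Perfect"
| "after m (i, j, t) a =
     (if a = PM then map_pmf (\<lambda>b. if b then Perfect else i) (bernoulli_pmf (pr m))
      else return_pmf i)"

fun residual :: "model \<Rightarrow> state \<Rightarrow> real" where
  "residual m (i, j, t) = (if j = SO then tau m else t)"

definition stateM :: "model \<Rightarrow> state measure" where
  "stateM m =
     restrict_space (count_space UNIV \<Otimes>\<^sub>M count_space UNIV \<Otimes>\<^sub>M borel) (state_space m)"

definition timed_stateM :: "model \<Rightarrow> (real \<times> state) measure" where
  "timed_stateM m = borel \<Otimes>\<^sub>M stateM m"

text \<open>Joint law of the sojourn time and the next state, given that the condition after the
  action is \<open>k\<close> and that the next scheduled opportunity is \<open>r\<close> time units away.\<close>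

definition next_law :: "model \<Rightarrow> condition \<Rightarrow> real \<Rightarrow> (real \<times> state) measure" where
  "next_law m k r = measure_of (space (timed_stateM m)) (sets (timed_stateM m))
     (\<lambda>B. (\<integral>\<^sup>+ s. ennreal (rate m k * exp (- (uso_rate m + rate m k) * s))
                 * indicator B (s, (k, SC, r - s)) * indicator {0<..<r} s \<partial>lborel)
         + (\<integral>\<^sup>+ s. ennreal (uso_rate m * exp (- (uso_rate m + rate m k) * s))
                 * indicator B (s, (k, USO, r - s)) * indicator {0<..<r} s \<partial>lborel)
         + ennreal (exp (- (uso_rate m + rate m k) * r)) * indicator B (r, (k, SO, 0)))"

definition transition_law :: "model \<Rightarrow> state \<Rightarrow> action \<Rightarrow> (real \<times> state) measure" where
  "transition_law m x a = measure_pmf (after m x a) \<bind> (\<lambda>k. next_law m k (residual m x))"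

text \<open>Deterministic stationary policies. Measurability is what makes the law of the controlled
  process well defined; the values of a policy outside the state space are irrelevant.\<close>

definition policies :: "model \<Rightarrow> policy set" where
  "policies m = {f. f \<in> stateM m \<rightarrow>\<^sub>M count_space UNIV \<and>
                    (\<forall>x \<in> state_space m. f x \<in> admissible x)}"

text \<open>Trajectories are sequences \<open>\<omega>\<close> with \<open>\<omega> n\<close> the pair of the \<open>n\<close>-th transition epoch and the
  state at that epoch. The function \<open>step\<close> gives the conditional law of \<open>\<omega> n\<close> given
  \<open>\<omega> 0, \<dots>, \<omega> (n - 1)\<close>.\<close>

fun step :: "model \<Rightarrow> policy \<Rightarrow> state \<Rightarrow> nat \<Rightarrow> (nat \<Rightarrow> real \<times> state) \<Rightarrow> (real \<times> state) measure" where
  "step m f x 0 \<omega> = return (timed_stateM m) (0, x)"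
| "step m f x (Suc n) \<omega> =
     distr (transition_law m (snd (\<omega> n)) (f (snd (\<omega> n)))) (timed_stateM m)
       (\<lambda>(s, y). (fst (\<omega> n) + s, y))"

text \<open>The measure on trajectories with these conditional laws (Ionescu-Tulcea theorem).\<close>

definition process :: "model \<Rightarrow> policy \<Rightarrow> state \<Rightarrow> (nat \<Rightarrow> real \<times> state) measure" where
  "process m f x =
     projective_family.lim UNIV (Ionescu_Tulcea.CI (step m f x) (\<lambda>_. timed_stateM m))
       (\<lambda>_. timed_stateM m)"

definition epoch_time :: "nat \<Rightarrow> (nat \<Rightarrow> real \<times> state) \<Rightarrow> real" where
  "epoch_time n \<omega> = fst (\<omega> n)"

definition state_at :: "nat \<Rightarrow> (nat \<Rightarrow> real \<times> state) \<Rightarrow> state" where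
  "state_at n \<omega> = snd (\<omega> n)"

definition average_cost :: "model \<Rightarrow> state \<Rightarrow> policy \<Rightarrow> ereal" where
  "average_cost m x f = limsup (\<lambda>n. ereal
     ((\<integral>\<omega>. (\<Sum>k<n. cost m (state_at k \<omega>) (f (state_at k \<omega>))) \<partial>process m f x)
      / (\<integral>\<omega>. epoch_time n \<omega> \<partial>process m f x)))"

definition optimal :: "model \<Rightarrow> policy \<Rightarrow> bool" where
  "optimal m f \<longleftrightarrow> f \<in> policies m \<and>
     (\<forall>x \<in> state_space m. average_cost m x f = (INF g \<in> policies m. average_cost m x g))"

text \<open>Never maintain in condition 2; in condition 1 maintain at a scheduled opportunity iff \<open>b\<close>,
  and at an unscheduled one iff the time to the next scheduled opportunity lies in \<open>R\<close>.\<close>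

fun pm_policy :: "bool \<Rightarrow> real set \<Rightarrow> policy" where
  "pm_policy b R (Satisfactory, SC, t) = CM"
| "pm_policy b R (Satisfactory, USO, t) = (if t \<in> R then PM else DoNothing)"
| "pm_policy b R (Satisfactory, SO, t) = (if b then PM else DoNothing)"
| "pm_policy b R (Perfect, j, t) = DoNothing"

end

theory Submission
  imports Defs
begin

text \<open>
  Write \<open>\<Delta> t\<close> for the difference of the relative values of conditions 1 and 2 when the next
  scheduled opportunity is \<open>t\<close> away. Maintenance in condition 1 costs its price and turns a
  value difference \<open>\<Delta>\<close> into \<open>(1 - p) \<Delta>\<close>, so it pays off exactly if its price is at most
  \<open>p \<Delta>\<close>; in condition 2 it changes nothing and never pays off. The average cost optimality
  equation thus reduces to one scalar differential equation
  \<open>\<Delta>' = \<mu>1 c_cm - (\<mu>1 + \<mu>2) \<Delta> + \<lambda> min 0 (c_uso - p \<Delta>)\<close> with the boundary condition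
  \<open>\<Delta> 0 = \<Delta> \<tau> + min 0 (c_so - p \<Delta> \<tau>)\<close> that expresses the decision at the scheduled
  opportunity. The relative values themselves and the optimal average cost are recovered from
  \<open>\<Delta>\<close> by one integration.

  Any solution of this boundary value problem yields an optimal policy (lemma
  \<open>optimal_pm_policy\<close>). It gives a bounded function \<open>h\<close> on the states and a constant \<open>g\<close>
  satisfying the optimality equation; summing its one-step version along the controlled process
  shows that the expected cost of the first \<open>n\<close> steps of any policy is at least
  \<open>g\<close> times the expected \<open>n\<close>-th transition epoch up to a bounded error, with equality for the
  policy read off from \<open>\<Delta>\<close>. Since the expected epochs tend to infinity
  (\<open>mean_epoch_unbounded\<close>), \<open>g\<close> is the optimal average cost
  (\<open>optimal_if_optimality_equation\<close>). All expectations only involve the one-dimensional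
  marginals of the process, which evolve by a Markov kernel (\<open>marginal_Suc\<close>).

  It remains to solve the boundary value problem. The right-hand side is affine on either side of
  the level \<open>c_uso / p\<close>: without unscheduled maintenance \<open>\<Delta>\<close> relaxes exponentially, with rate
  \<open>\<mu>1 + \<mu>2\<close>, to \<open>rest_level\<close>; with it, \<open>\<Delta>\<close> relaxes with rate
  \<open>\<mu>1 + \<mu>2 + \<lambda> p\<close> to \<open>pm_level\<close>. If scheduled maintenance is worthwhile, \<open>\<Delta>\<close>
  increases in \<open>t\<close>, so the unscheduled opportunities worth using are those whose residual time
  exceeds the one at which \<open>\<Delta>\<close> crosses \<open>c_uso / p\<close>, and the threshold
  equation says that a trajectory crossing there satisfies the boundary condition.

  The exact criterion for unscheduled maintenance to be worthwhile is \<open>uso_profitable\<close>, that is,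
  \<open>rest_level > c_uso / p + (c_uso - c_so) / (exp ((\<mu>1 + \<mu>2) \<tau>) - 1)\<close>. The condition
  \<open>uso_pm\<close> of the theorem, with a minus sign in place of this plus sign, is weaker. The two
  are reconciled by the location of the roots of the threshold equation: there is a root
  below \<open>\<tau>\<close> if \<open>uso_profitable\<close> holds (\<open>ex_so_gap_root\<close>), and if it fails then the equation either
  has no root or has one at or beyond \<open>\<tau>\<close> (\<open>so_gap_root_after_tau\<close>), for which the maintenance
  interval is empty.
\<close>

section \<open>Measurability of states\<close>

abbreviation raw_stateM :: "state measure" where
  "raw_stateM \<equiv> count_space UNIV \<Otimes>\<^sub>M count_space UNIV \<Otimes>\<^sub>M borel"

lemma space_raw_stateM: "space raw_stateM = UNIV"
  by (simp add: space_pair_measure)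

lemma space_stateM: "space (stateM m) = state_space m"
  by (simp add: stateM_def space_restrict_space space_raw_stateM)

lemma space_timed_stateM: "space (timed_stateM m) = UNIV \<times> state_space m"
  by (simp add: timed_stateM_def space_pair_measure space_stateM)

lemma measurable_stateM:
  assumes "f \<in> N \<rightarrow>\<^sub>M raw_stateM" "\<And>x. x \<in> space N \<Longrightarrow> f x \<in> state_space m"
  shows "f \<in> N \<rightarrow>\<^sub>M stateM m"
  unfolding stateM_def using assms by (intro measurable_restrict_space2) auto

lemma measurable_from_raw: "f \<in> raw_stateM \<rightarrow>\<^sub>M N \<Longrightarrow> f \<in> stateM m \<rightarrow>\<^sub>M N"
  unfolding stateM_def by (rule measurable_restrict_space1)

lemma measurable_condition_stateM [measurable]: "fst \<in> stateM m \<rightarrow>\<^sub>M count_space UNIV"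
  and measurable_epoch_stateM [measurable]: "(\<lambda>x. fst (snd x)) \<in> stateM m \<rightarrow>\<^sub>M count_space UNIV"
  and measurable_clock_stateM [measurable]: "(\<lambda>x. snd (snd x)) \<in> stateM m \<rightarrow>\<^sub>M borel"
  by (rule measurable_from_raw, measurable)+

lemma measurable_residual [measurable]: "residual m \<in> stateM m \<rightarrow>\<^sub>M borel"
proof -
  have "residual m = (\<lambda>x. if fst (snd x) = SO then tau m else snd (snd x))"
    by (auto simp: fun_eq_iff)
  then show ?thesis by simp
qed

lemma UNIV_condition: "(UNIV :: condition set) = {Satisfactory, Perfect}"
  by (rule UNIV_eq_I) (metis condition.exhaust insertCI)

lemma UNIV_epoch: "(UNIV :: epoch set) = {SC, USO, SO}"
  by (rule UNIV_eq_I) (metis epoch.exhaust insertCI)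

lemma measurable_state_cases:
  assumes F: "\<And>i j. F i j \<in> stateM m \<rightarrow>\<^sub>M K"
  shows "(\<lambda>x. F (fst x) (fst (snd x)) x) \<in> stateM m \<rightarrow>\<^sub>M K"
proof -
  have fin: "countable (UNIV :: condition set)" "countable (UNIV :: epoch set)"
    by (simp_all add: UNIV_condition UNIV_epoch)
  have "(\<lambda>x. F i (fst (snd x)) x) \<in> stateM m \<rightarrow>\<^sub>M K" for i
    by (rule measurable_compose_countable'[where g="\<lambda>x. fst (snd x)" and I=UNIV])
       (use F fin in auto)
  then show ?thesis
    by (rule measurable_compose_countable'[where g=fst and I=UNIV]) (use fin in auto)
qed

lemma measurable_discrete_data:
  assumes f: "f \<in> stateM m \<rightarrow>\<^sub>M count_space UNIV" and F: "\<And>i j a. F i j a \<in> space K"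
  shows "(\<lambda>x. F (fst x) (fst (snd x)) (f x)) \<in> stateM m \<rightarrow>\<^sub>M K"
  by (rule measurable_state_cases, rule measurable_compose[OF f]) (simp add: F)

lemma residual_pos: "0 < tau m \<Longrightarrow> x \<in> state_space m \<Longrightarrow> 0 < residual m x \<and> residual m x \<le> tau m"
  by (auto simp: state_space_def)

text \<open>The elapsed time \<open>s\<close> and the residual time \<open>r\<close> vary jointly here, because the transition
  law has to depend measurably on \<open>r\<close>. The target \<open>(s, (k, j, r - s))\<close> is a point of
  \<^term>\<open>timed_stateM m\<close> only for \<open>0 < s < r \<le> tau m\<close>, whence the indicator and the restriction
  of \<open>r\<close>.\<close>
lemma measurable_jump_target:
  assumes H: "H \<in> borel_measurable (timed_stateM m)" and j: "j = SC \<or> j = USO"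
  shows "(\<lambda>(r, s). (H (s, (k, j, r - s)) :: ennreal) * indicator {0<..<r} s)
    \<in> borel_measurable (restrict_space borel {0<..tau m} \<Otimes>\<^sub>M borel)"
proof -
  let ?M = "restrict_space borel {0<..tau m} \<Otimes>\<^sub>M (borel :: real measure)"
  define W where "W = {z \<in> space ?M. 0 < snd z \<and> snd z < fst z}"
  have fst_b: "fst \<in> borel_measurable ?M"
    by (rule measurable_compose[OF measurable_fst]) (simp add: measurable_restrict_space1)
  note [measurable] = fst_b
  have W: "W \<in> sets ?M" unfolding W_def by measurable
  have 1: "(\<lambda>z. (snd z, (k, j, fst z - snd z))) \<in> restrict_space ?M W \<rightarrow>\<^sub>M timed_stateM m"
    unfolding timed_stateM_def
  proof (rule measurable_Pair)
    show "snd \<in> restrict_space ?M W \<rightarrow>\<^sub>M borel"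
      by (rule measurable_restrict_space1) simp
    show "(\<lambda>z. (k, j, fst z - snd z)) \<in> restrict_space ?M W \<rightarrow>\<^sub>M stateM m"
    proof (rule measurable_stateM)
      show "(\<lambda>z. (k, j, fst z - snd z)) \<in> restrict_space ?M W \<rightarrow>\<^sub>M raw_stateM"
        by (rule measurable_restrict_space1) measurable
    qed (use j in \<open>auto simp: space_restrict_space W_def state_space_def space_pair_measure\<close>)
  qed
  have "(\<lambda>z. H (snd z, (k, j, fst z - snd z))) \<in> borel_measurable (restrict_space ?M W)"
    by (rule measurable_compose[OF 1 H])
  then have "(\<lambda>z. H (snd z, (k, j, fst z - snd z)) * indicator W z) \<in> borel_measurable ?M"
    using W by (subst (asm) borel_measurable_restrict_space_iff_ennreal) (auto simp: W_def)
  then show ?thesis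
    by (rule measurable_cong[THEN iffD1, rotated]) (auto simp: W_def split: split_indicator)
qed

lemma measurable_jump_target_fixed:
  assumes H: "H \<in> borel_measurable (timed_stateM m)" and j: "j = SC \<or> j = USO"
    and r: "0 < r" "r \<le> tau m"
  shows "(\<lambda>s. (H (s, (k, j, r - s)) :: ennreal) * indicator {0<..<r} s) \<in> borel_measurable borel"
proof -
  have "Pair r \<in> borel \<rightarrow>\<^sub>M (restrict_space borel {0<..tau m} \<Otimes>\<^sub>M (borel :: real measure))"
    by (rule measurable_Pair1') (use r in \<open>auto simp: space_restrict_space\<close>)
  from measurable_compose[OF this measurable_jump_target[OF H j, of k]] show ?thesis by simp
qed

section \<open>The law of the sojourn time and the next state\<close>

locale maintenance_model =
  fixes m :: model
  assumes mu1_pos: "0 < mu1 m" and mu2_pos: "0 < mu2 m" and uso_rate_pos: "0 < uso_rate m"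
    and tau_pos: "0 < tau m" and pr_nonneg: "0 \<le> pr m" and pr_le_1: "pr m \<le> 1"
    and cost_so_nonneg: "0 \<le> cost_so m" and cost_uso_nonneg: "0 \<le> cost_uso m"
    and cost_cm_nonneg: "0 \<le> cost_cm m"
begin

lemma rate_pos: "0 < rate m k"
  by (cases k) (simp_all add: mu1_pos mu2_pos)

abbreviation event_rate :: "condition \<Rightarrow> real" where
  "event_rate k \<equiv> uso_rate m + rate m k"

lemma event_rate_pos: "0 < event_rate k"
  using rate_pos[of k] uso_rate_pos by simp

abbreviation jump_density where
  "jump_density c k j r H s \<equiv>
     ennreal (c * exp (- event_rate k * s)) * (H (s, (k, j, r - s)) * indicator {0<..<r} s)"

text \<open>The integral of \<open>H\<close> under \<^term>\<open>next_law m k r\<close>, written out: two densities for the next change of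
  condition and the next unscheduled opportunity, and an atom for reaching the scheduled one.\<close>

definition next_integral :: "condition \<Rightarrow> real \<Rightarrow> (real \<times> state \<Rightarrow> ennreal) \<Rightarrow> ennreal" where
  "next_integral k r H =
     (\<integral>\<^sup>+ s. jump_density (rate m k) k SC r H s \<partial>lborel)
   + (\<integral>\<^sup>+ s. jump_density (uso_rate m) k USO r H s \<partial>lborel)
   + ennreal (exp (- event_rate k * r)) * H (r, (k, SO, 0))"

lemma next_law_eq: "next_law m k r =
    measure_of (space (timed_stateM m)) (sets (timed_stateM m)) (\<lambda>B. next_integral k r (indicator B))"
  unfolding next_law_def next_integral_def by (simp add: mult.assoc)

lemma sets_next_law [simp, measurable_cong]: "sets (next_law m k r) = sets (timed_stateM m)"
  and space_next_law [simp]: "space (next_law m k r) = space (timed_stateM m)"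
  by (simp_all add: next_law_def)

lemma measurable_density_jump:
  assumes "H \<in> borel_measurable (timed_stateM m)" "j = SC \<or> j = USO" "0 < r" "r \<le> tau m"
  shows "(\<lambda>s. jump_density c k j r H s)
    \<in> borel_measurable lborel"
  using measurable_jump_target_fixed[OF assms, of k] by measurable

text \<open>The definition of \<^const>\<open>next_law\<close> is through \<^const>\<open>measure_of\<close>, so its set function is of
  use only once it is known to be countably additive; this is that fact, for functions.\<close>
lemma next_integral_suminf:
  assumes H: "\<And>i. H i \<in> borel_measurable (timed_stateM m)" and r: "0 < r" "r \<le> tau m"
  shows "(\<Sum>i. next_integral k r (H i)) = next_integral k r (\<lambda>z. \<Sum>i. H i z)"
proof -
  have "next_integral k r (\<lambda>z. \<Sum>i. H i z) =
     (\<integral>\<^sup>+ s. (\<Sum>i. jump_density (rate m k) k SC r (H i) s) \<partial>lborel)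
   + (\<integral>\<^sup>+ s. (\<Sum>i. jump_density (uso_rate m) k USO r (H i) s) \<partial>lborel)
   + (\<Sum>i. ennreal (exp (- event_rate k * r)) * H i (r, (k, SO, 0)))"
    unfolding next_integral_def by (simp only: ennreal_suminf_cmult ennreal_suminf_multc)
  also have "\<dots> = (\<Sum>i. next_integral k r (H i))"
    unfolding next_integral_def
    using H r measurable_density_jump
    by (subst (1 2) nn_integral_suminf) (auto simp: suminf_add[OF summableI summableI, symmetric])
  finally show ?thesis by simp
qed

lemma emeasure_next_law:
  assumes r: "0 < r" "r \<le> tau m" and B: "B \<in> sets (timed_stateM m)"
  shows "emeasure (next_law m k r) B = next_integral k r (indicator B)"
  unfolding next_law_eq
proof (rule emeasure_measure_of_sigma)
  show "sigma_algebra (space (timed_stateM m)) (sets (timed_stateM m))" ..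
  show "positive (sets (timed_stateM m)) (\<lambda>B. next_integral k r (indicator B))"
    by (simp add: positive_def next_integral_def)
  show "countably_additive (sets (timed_stateM m)) (\<lambda>B. next_integral k r (indicator B))"
  proof (rule countably_additiveI)
    fix A :: "nat \<Rightarrow> _" assume A: "range A \<subseteq> sets (timed_stateM m)" "disjoint_family A"
    have "(\<Sum>i. next_integral k r (indicator (A i))) = next_integral k r (\<lambda>z. \<Sum>i. indicator (A i) z)"
      by (rule next_integral_suminf) (use A r in auto)
    also have "(\<lambda>z. \<Sum>i. indicator (A i) z :: ennreal) = indicator (\<Union>i. A i)"
      using A(2) by (simp add: suminf_indicator fun_eq_iff)
    finally show "(\<Sum>i. next_integral k r (indicator (A i))) = next_integral k r (indicator (\<Union>i. A i))" .
  qed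
qed (rule B)

lemma nn_integral_next_law:
  assumes r: "0 < r" "r \<le> tau m" and H: "H \<in> borel_measurable (timed_stateM m)"
  shows "(\<integral>\<^sup>+ z. H z \<partial>next_law m k r) = next_integral k r H"
proof -
  have in_space: "(r, (k, SO, 0)) \<in> space (timed_stateM m)"
    "\<And>s j. 0 < s \<Longrightarrow> s < r \<Longrightarrow> j = SC \<or> j = USO \<Longrightarrow> (s, (k, j, r - s)) \<in> space (timed_stateM m)"
    using r by (auto simp: space_timed_stateM state_space_def)
  show ?thesis
    using H
  proof (induction rule: borel_measurable_induct)
    case (cong f g)
    have "next_integral k r f = next_integral k r g"
      unfolding next_integral_def
      by (intro arg_cong2[where f="(+)"] nn_integral_cong)
         (auto simp: cong(3) in_space split: split_indicator)
    with cong show ?case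
      by (metis nn_integral_cong space_next_law)
  next
    case (set B)
    then show ?case by (simp add: emeasure_next_law r)
  next
    case (mult u c)
    have "next_integral k r (\<lambda>x. c * u x) = c * next_integral k r u"
      unfolding next_integral_def distrib_left
      using mult measurable_density_jump[OF _ _ r]
      by (subst (1 2) nn_integral_cmult[symmetric]) (auto simp: mult_ac)
    with mult show ?case by (simp add: nn_integral_cmult)
  next
    case (add u v)
    have "next_integral k r (\<lambda>x. v x + u x) = next_integral k r v + next_integral k r u"
      unfolding next_integral_def distrib_left distrib_right
      using add measurable_density_jump[OF _ _ r]
      by (subst (1 2) nn_integral_add) (auto simp: algebra_simps)
    with add show ?case by (simp add: nn_integral_add)
  next
    case (seq U)
    have mono: "incseq (\<lambda>i. U i z)" for z
      using seq(3) unfolding incseq_def le_fun_def by blast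
    have mono': "incseq (\<lambda>i s. jump_density c k j r (U i) s)"
      for c j
      unfolding incseq_def le_fun_def using mono by (auto simp: incseq_def intro!: mult_mono)
    have "next_integral k r (\<lambda>z. SUP i. U i z) =
         (\<integral>\<^sup>+ s. (SUP i. jump_density (rate m k) k SC r (U i) s) \<partial>lborel)
       + (\<integral>\<^sup>+ s. (SUP i. jump_density (uso_rate m) k USO r (U i) s) \<partial>lborel)
       + (SUP i. ennreal (exp (- event_rate k * r)) * U i (r, (k, SO, 0)))"
      unfolding next_integral_def by (simp only: SUP_mult_left_ennreal SUP_mult_right_ennreal)
    also have "\<dots> = (SUP i. next_integral k r (U i))"
    proof -
      have pull: "(\<integral>\<^sup>+ s. (SUP i. jump_density c k j r (U i) s) \<partial>lborel)
        = (SUP i. \<integral>\<^sup>+ s. jump_density c k j r (U i) s \<partial>lborel)"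
        and inc: "incseq (\<lambda>i. \<integral>\<^sup>+ s. jump_density c k j r (U i) s \<partial>lborel)"
        if "j = SC \<or> j = USO" for c j
        using measurable_density_jump[OF seq(1) that r] mono'
        by (auto intro!: nn_integral_monotone_convergence_SUP incseq_nn_integral)
      have i3: "incseq (\<lambda>i. ennreal (exp (- event_rate k * r)) * U i (r, (k, SO, 0)))"
        using mono by (auto simp: incseq_def intro!: mult_left_mono)
      note i1 = inc[of SC "rate m k", OF disjI1[OF refl]] and i2 = inc[of USO "uso_rate m", OF disjI2[OF refl]]
      have i12: "incseq (\<lambda>i. F i + G i :: ennreal)" if "incseq F" "incseq G" for F G
        using that by (auto simp: incseq_def intro!: add_mono)
      show ?thesis
        unfolding next_integral_def pull[of SC "rate m k", OF disjI1[OF refl]]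
          pull[of USO "uso_rate m", OF disjI2[OF refl]] ennreal_SUP_add[OF i12[OF i1 i2] i3]
          ennreal_SUP_add[OF i1 i2] ..
    qed
    finally have "next_integral k r (\<lambda>z. SUP i. U i z) = (SUP i. next_integral k r (U i))" .
    moreover have "(\<integral>\<^sup>+ z. (SUP i. U i z) \<partial>next_law m k r) = (SUP i. \<integral>\<^sup>+ z. U i z \<partial>next_law m k r)"
      by (rule nn_integral_monotone_convergence_SUP) (use seq in auto)
    ultimately show ?case using seq by (simp add: image_comp SUP_apply)
  qed
qed

text \<open>First-step analysis. If \<open>v\<close> solves the backward equation with running cost rate \<open>- g\<close> and
  jump targets \<open>a\<close> and \<open>b\<close>, then \<open>- exp (- \<Lambda> s) (C + v (r - s) - g s)\<close>, with \<open>\<Lambda>\<close> the total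
  event rate, is an antiderivative of the density-weighted integrand, and the atom at \<open>r\<close>
  contributes its boundary term. The constant \<open>C\<close> makes the integrand
  nonnegative.\<close>
lemma next_integral_eq_value:
  assumes r: "0 < r" "r \<le> tau m" and H: "H \<in> borel_measurable (timed_stateM m)"
    and v_cont: "continuous_on {0..tau m} v"
    and v_ode: "\<And>t. 0 < t \<Longrightarrow> t < tau m \<Longrightarrow>
      (v has_real_derivative rate m k * a t + uso_rate m * b t - event_rate k * v t - g) (at t)"
    and H_SC: "\<And>s. 0 < s \<Longrightarrow> s < r \<Longrightarrow> H (s, (k, SC, r - s)) = ennreal (C + a (r - s) - g * s)"
    and H_USO: "\<And>s. 0 < s \<Longrightarrow> s < r \<Longrightarrow> H (s, (k, USO, r - s)) = ennreal (C + b (r - s) - g * s)"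
    and H_SO: "H (r, (k, SO, 0)) = ennreal (C + v 0 - g * r)"
    and nonneg: "\<And>s. 0 < s \<Longrightarrow> s < r \<Longrightarrow> 0 \<le> C + a (r - s) - g * s"
      "\<And>s. 0 < s \<Longrightarrow> s < r \<Longrightarrow> 0 \<le> C + b (r - s) - g * s" "0 \<le> C + v 0 - g * r"
  shows "next_integral k r H = ennreal (C + v r) \<and> 0 \<le> C + v r"
proof -
  let ?e = "\<lambda>s. exp (- event_rate k * s)"
  define q where "q s = ?e s * (rate m k * (C + a (r - s) - g * s) + uso_rate m * (C + b (r - s) - g * s))" for s
  define \<Phi> where "\<Phi> s = - (?e s * (C + v (r - s) - g * s))" for s
  have q_nonneg: "0 \<le> q s" if "0 < s" "s < r" for s
    using nonneg(1,2)[OF that] rate_pos[of k] uso_rate_pos unfolding q_def by simp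
  have "(q has_integral (\<Phi> r - \<Phi> 0)) {0..r}"
  proof (rule fundamental_theorem_of_calculus_interior)
    show "0 \<le> r" using r by simp
    have "continuous_on {0..r} (\<lambda>s. v (r - s))"
      by (rule continuous_on_compose2[OF v_cont]) (use r in \<open>auto intro!: continuous_intros\<close>)
    then show "continuous_on {0..r} \<Phi>"
      unfolding \<Phi>_def by (intro continuous_intros)
    fix s assume s: "s \<in> {0<..<r}"
    have "((\<lambda>s. v (r - s)) has_real_derivative
        (rate m k * a (r - s) + uso_rate m * b (r - s) - event_rate k * v (r - s) - g) * (- 1)) (at s)"
      by (rule DERIV_chain2[where g="\<lambda>s. r - s", OF v_ode])
         (use s r in \<open>auto intro!: derivative_eq_intros\<close>)
    then have "(\<Phi> has_real_derivative q s) (at s)"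
      unfolding \<Phi>_def q_def by (auto intro!: derivative_eq_intros simp: algebra_simps)
    then show "(\<Phi> has_vector_derivative q s) (at s)"
      by (simp add: has_real_derivative_iff_has_vector_derivative)
  qed
  then have q_int: "(q has_integral (\<Phi> r - \<Phi> 0)) {0<..<r}"
    by (simp add: has_integral_Icc_iff_Ioo)
  have "(\<integral>\<^sup>+ s. ennreal (rate m k * ?e s) * (H (s, (k, SC, r - s)) * indicator {0<..<r} s) \<partial>lborel)
      + (\<integral>\<^sup>+ s. ennreal (uso_rate m * ?e s) * (H (s, (k, USO, r - s)) * indicator {0<..<r} s) \<partial>lborel)
      = (\<integral>\<^sup>+ s. ennreal (q s) * indicator {0<..<r} s \<partial>lborel)"
    using measurable_density_jump[OF H _ r]
  proof (subst nn_integral_add[symmetric], simp, simp, intro nn_integral_cong)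
    fix s
    show "ennreal (rate m k * ?e s) * (H (s, (k, SC, r - s)) * indicator {0<..<r} s)
        + ennreal (uso_rate m * ?e s) * (H (s, (k, USO, r - s)) * indicator {0<..<r} s)
        = ennreal (q s) * indicator {0<..<r} s"
    proof (cases "s \<in> {0<..<r}")
      case True
      then have s: "0 < s" "s < r" by auto
      have "ennreal (q s) = ennreal (rate m k * ?e s * (C + a (r - s) - g * s)
          + uso_rate m * ?e s * (C + b (r - s) - g * s))"
        unfolding q_def by (simp add: algebra_simps)
      also have "\<dots> = ennreal (rate m k * ?e s) * ennreal (C + a (r - s) - g * s)
          + ennreal (uso_rate m * ?e s) * ennreal (C + b (r - s) - g * s)"
        using nonneg(1,2)[OF s] rate_pos[of k] uso_rate_pos
        by (simp add: ennreal_plus[symmetric] ennreal_mult[symmetric] del: ennreal_plus)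
      finally show ?thesis using True s by (simp add: H_SC H_USO)
    qed simp
  qed
  also have "\<dots> = ennreal (\<Phi> r - \<Phi> 0)"
    by (rule nn_integral_has_integral_lebesgue'[OF q_nonneg q_int]) auto
  finally have "next_integral k r H = ennreal (\<Phi> r - \<Phi> 0) + ennreal (?e r) * ennreal (C + v 0 - g * r)"
    unfolding next_integral_def H_SO by simp
  also have "\<dots> = ennreal (\<Phi> r - \<Phi> 0 + ?e r * (C + v 0 - g * r))"
    using nonneg(3) has_integral_nonneg[OF q_int] q_nonneg by (simp add: ennreal_mult)
  also have eq: "\<Phi> r - \<Phi> 0 + ?e r * (C + v 0 - g * r) = C + v r"
    by (simp add: \<Phi>_def)
  finally have "next_integral k r H = ennreal (C + v r)" .
  moreover have "0 \<le> \<Phi> r - \<Phi> 0 + ?e r * (C + v 0 - g * r)"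
    using nonneg(3) has_integral_nonneg[OF q_int] q_nonneg by simp
  ultimately show ?thesis unfolding eq by simp
qed

text \<open>Total mass 1 is the special case of the value \<open>0\<close> and the constant \<open>1\<close>.\<close>
lemma prob_space_next_law:
  assumes r: "0 < r" "r \<le> tau m"
  shows "prob_space (next_law m k r)"
proof
  have "emeasure (next_law m k r) (space (next_law m k r)) = (\<integral>\<^sup>+ z. 1 \<partial>next_law m k r)"
    by simp
  also have "\<dots> = next_integral k r (\<lambda>_. 1)"
    by (rule nn_integral_next_law[OF r]) simp
  also have "\<dots> = ennreal (1 + 0)"
    by (rule next_integral_eq_value[where v="\<lambda>_. 0" and a="\<lambda>_. 0" and b="\<lambda>_. 0" and g=0, OF r, THEN conjunct1]) auto
  finally show "emeasure (next_law m k r) (space (next_law m k r)) = 1" by simp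
qed

lemma AE_next_law:
  assumes r: "0 < r" "r \<le> tau m"
  shows "AE z in next_law m k r. 0 < fst z \<and> fst z \<le> tau m"
proof -
  let ?B = "{z \<in> space (timed_stateM m). \<not> (0 < fst z \<and> fst z \<le> tau m)}"
  have [measurable]: "fst \<in> borel_measurable (timed_stateM m)"
    unfolding timed_stateM_def by simp
  have B: "?B \<in> sets (timed_stateM m)" by measurable
  have "emeasure (next_law m k r) ?B = next_integral k r (indicator ?B)"
    by (rule emeasure_next_law[OF r B])
  also have "\<dots> = next_integral k r (\<lambda>_. 0)"
    unfolding next_integral_def using r
    by (intro arg_cong2[where f="(+)"] nn_integral_cong) (auto split: split_indicator)
  finally have "emeasure (next_law m k r) ?B = 0" by (simp add: next_integral_def)
  then show ?thesis
    by (intro AE_I[where N="?B"]) (use B in auto)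
qed

lemma measurable_next_law:
  "next_law m k \<in> restrict_space borel {0<..tau m} \<rightarrow>\<^sub>M prob_algebra (timed_stateM m)"
proof (rule measurable_prob_algebraI)
  let ?R = "restrict_space borel {0<..tau m} :: real measure"
  show "prob_space (next_law m k r)" if "r \<in> space ?R" for r
    using that by (intro prob_space_next_law) (auto simp: space_restrict_space)
  show "next_law m k \<in> ?R \<rightarrow>\<^sub>M subprob_algebra (timed_stateM m)"
  proof (rule measurable_subprob_algebra)
    show "subprob_space (next_law m k r)" if "r \<in> space ?R" for r
      using that by (intro prob_space_imp_subprob_space prob_space_next_law) (auto simp: space_restrict_space)
    fix B assume B: "B \<in> sets (timed_stateM m)"
    have id: "(\<lambda>r. r) \<in> borel_measurable ?R"
      by (rule measurable_restrict_space1) simp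
    have jump: "(\<lambda>r. \<integral>\<^sup>+ s. jump_density c k j r (indicator B) s \<partial>lborel) \<in> borel_measurable ?R"
      if j: "j = SC \<or> j = USO" for c j
    proof -
      have "(\<lambda>(r, s). indicator B (s, (k, j, r - s)) * indicator {0<..<r} s :: ennreal)
          \<in> borel_measurable (?R \<Otimes>\<^sub>M lborel)"
        using measurable_jump_target[of "indicator B" m j k] j B
        by (simp add: measurable_cong_sets[OF sets_pair_measure_cong[OF refl sets_lborel] refl])
      then show ?thesis
        by (intro lborel.borel_measurable_nn_integral) (simp add: case_prod_beta')
    qed
    have "(\<lambda>r. (r, (k, SO, 0 :: real))) \<in> ?R \<rightarrow>\<^sub>M timed_stateM m"
      unfolding timed_stateM_def using id
      by (intro measurable_Pair measurable_stateM) (auto simp: state_space_def)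
    from measurable_compose[OF this borel_measurable_indicator[OF B]]
    have "(\<lambda>r. next_integral k r (indicator B)) \<in> borel_measurable ?R"
      unfolding next_integral_def using jump[of SC] jump[of USO] id by measurable
    then show "(\<lambda>r. emeasure (next_law m k r) B) \<in> borel_measurable ?R"
      by (rule measurable_cong[THEN iffD1, rotated])
         (auto simp: emeasure_next_law B space_restrict_space)
  qed simp
qed

end

section \<open>Controlled transitions and the marginals of the process\<close>

context maintenance_model
begin

lemma after_eq: "after m x a = after m (fst x, fst (snd x), 0) a"
  by (cases x; cases "fst x"; cases "fst (snd x)") auto

lemma measurable_transition_law:
  assumes f: "f \<in> policies m"
  shows "(\<lambda>x. transition_law m x (f x)) \<in> stateM m \<rightarrow>\<^sub>M prob_algebra (timed_stateM m)"
  unfolding transition_law_def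
proof (rule measurable_bind_prob_space2[where N="count_space UNIV"])
  have "(\<lambda>x. measure_pmf (after m (fst x, fst (snd x), 0) (f x))) \<in> stateM m \<rightarrow>\<^sub>M prob_algebra (count_space UNIV)"
    by (rule measurable_discrete_data)
       (use f in \<open>auto simp: policies_def space_prob_algebra measure_pmf.prob_space_axioms\<close>)
  then show "(\<lambda>x. measure_pmf (after m x (f x))) \<in> stateM m \<rightarrow>\<^sub>M prob_algebra (count_space UNIV)"
    by (subst after_eq)
  show "(\<lambda>(x, k). next_law m k (residual m x)) \<in> stateM m \<Otimes>\<^sub>M count_space UNIV \<rightarrow>\<^sub>M prob_algebra (timed_stateM m)"
    unfolding case_prod_beta'
  proof (rule measurable_compose_countable'[where g=snd and I=UNIV])
    show "(\<lambda>z. next_law m k (residual m (fst z))) \<in> stateM m \<Otimes>\<^sub>M count_space UNIV \<rightarrow>\<^sub>M prob_algebra (timed_stateM m)" for k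
    proof (rule measurable_compose[OF _ measurable_next_law])
      show "(\<lambda>z. residual m (fst z)) \<in> stateM m \<Otimes>\<^sub>M count_space UNIV \<rightarrow>\<^sub>M restrict_space borel {0<..tau m}"
        by (rule measurable_restrict_space2)
           (use residual_pos[OF tau_pos] in \<open>auto simp: space_pair_measure space_stateM\<close>)
    qed
  qed (auto simp: UNIV_condition)
qed

definition step_kernel :: "policy \<Rightarrow> real \<times> state \<Rightarrow> (real \<times> state) measure" where
  "step_kernel f z = distr (transition_law m (snd z) (f (snd z))) (timed_stateM m) (\<lambda>(s, y). (fst z + s, y))"

lemma measurable_shift:
  "(\<lambda>(z, w). (fst z + fst w, snd w)) \<in> timed_stateM m \<Otimes>\<^sub>M timed_stateM m \<rightarrow>\<^sub>M timed_stateM m"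
  unfolding timed_stateM_def by measurable

lemma measurable_step_kernel:
  assumes f: "f \<in> policies m"
  shows "step_kernel f \<in> timed_stateM m \<rightarrow>\<^sub>M prob_algebra (timed_stateM m)"
  unfolding step_kernel_def case_prod_beta'
proof (rule measurable_distr_prob_space2)
  show "(\<lambda>z. transition_law m (snd z) (f (snd z))) \<in> timed_stateM m \<rightarrow>\<^sub>M prob_algebra (timed_stateM m)"
    by (rule measurable_compose[OF _ measurable_transition_law[OF f]])
       (simp add: timed_stateM_def)
  show "(\<lambda>(z, w). (fst z + fst w, snd w)) \<in> timed_stateM m \<Otimes>\<^sub>M timed_stateM m \<rightarrow>\<^sub>M timed_stateM m"
    by (rule measurable_shift)
qed

lemma step_Suc: "step m f x (Suc n) \<omega> = step_kernel f (\<omega> n)"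
  by (simp add: step_kernel_def)

lemma Ionescu_Tulcea_step:
  assumes f: "f \<in> policies m" and x: "x \<in> state_space m"
  shows "Ionescu_Tulcea (step m f x) (\<lambda>_. timed_stateM m)"
proof -
  have *: "step m f x i \<in> PiM {0..<i} (\<lambda>_. timed_stateM m) \<rightarrow>\<^sub>M prob_algebra (timed_stateM m)" for i
  proof (cases i)
    case 0
    have "return (timed_stateM m) (0, x) \<in> space (prob_algebra (timed_stateM m))"
      using x by (simp add: space_prob_algebra prob_space_return space_timed_stateM)
    moreover have "step m f x i = (\<lambda>_. return (timed_stateM m) (0, x))"
      by (simp add: 0 fun_eq_iff)
    ultimately show ?thesis by simp
  next
    case (Suc n)
    have "(\<lambda>\<omega>. step_kernel f (\<omega> n)) \<in> PiM {0..<i} (\<lambda>_. timed_stateM m) \<rightarrow>\<^sub>M prob_algebra (timed_stateM m)"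
    proof (rule measurable_compose[OF _ measurable_step_kernel[OF f]])
      show "(\<lambda>\<omega>. \<omega> n) \<in> PiM {0..<i} (\<lambda>_. timed_stateM m) \<rightarrow>\<^sub>M timed_stateM m"
        by (rule measurable_component_singleton) (simp add: Suc)
    qed
    then show ?thesis unfolding Suc step_Suc[abs_def] .
  qed
  show ?thesis
  proof (rule Ionescu_Tulcea.intro)
    show "step m f x i \<in> PiM {0..<i} (\<lambda>_. timed_stateM m) \<rightarrow>\<^sub>M subprob_algebra (timed_stateM m)" for i
      by (rule measurable_prob_algebraD[OF *])
    show "prob_space (step m f x i \<omega>)" if "\<omega> \<in> space (PiM {0..<i} (\<lambda>_. timed_stateM m))" for i \<omega>
      using measurable_space[OF * that] by (simp add: space_prob_algebra)
  qed
qed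

definition marginal :: "policy \<Rightarrow> state \<Rightarrow> nat \<Rightarrow> (real \<times> state) measure" where
  "marginal f x n = distr (process m f x) (timed_stateM m) (\<lambda>\<omega>. \<omega> n)"

lemma sets_process:
  assumes f: "f \<in> policies m" and x: "x \<in> state_space m"
  shows "sets (process m f x) = sets (PiM UNIV (\<lambda>_. timed_stateM m))"
proof -
  interpret Ionescu_Tulcea "step m f x" "\<lambda>_. timed_stateM m"
    by (rule Ionescu_Tulcea_step[OF f x])
  show ?thesis unfolding process_def by (rule PF.sets_lim)
qed

lemma measurable_coordinate_process:
  assumes f: "f \<in> policies m" and x: "x \<in> state_space m"
  shows "(\<lambda>\<omega>. \<omega> n) \<in> process m f x \<rightarrow>\<^sub>M timed_stateM m"
  by (subst measurable_cong_sets[OF sets_process[OF f x] refl]) simp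

text \<open>The conditional law of step \<open>n + 1\<close> depends on the past only through step \<open>n\<close>, so the
  one-dimensional marginals of the Ionescu-Tulcea measure satisfy the Markov recursion. This is
  all that the average cost criterion sees of the process.\<close>
lemma
  assumes f: "f \<in> policies m" and x: "x \<in> state_space m"
  shows marginal_0: "marginal f x 0 = return (timed_stateM m) (0, x)"
    and marginal_Suc: "marginal f x (Suc n) = marginal f x n \<bind> step_kernel f"
proof -
  interpret Ionescu_Tulcea "step m f x" "\<lambda>_. timed_stateM m"
    by (rule Ionescu_Tulcea_step[OF f x])
  let ?T = "timed_stateM m" let ?u = "\<lambda>_. undefined :: real \<times> state"
  have u: "?u \<in> space (PiM {0..<0::nat} (\<lambda>_. ?T))" by (auto simp: space_PiM PiE_iff)
  have CI: "CI {0..<n} = C 0 n ?u" for n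
  proof (rule measure_eqI)
    show "sets (CI {0..<n}) = sets (C 0 n ?u)"
      using sets_C[OF u, of n] by (simp add: CI_def)
    fix X assume "X \<in> sets (CI {0..<n})"
    then have X: "X \<in> sets (PiM {0..<n} (\<lambda>_. ?T))" by (simp add: CI_def)
    then show "emeasure (CI {0..<n}) X = emeasure (C 0 n ?u) X"
      by (subst emeasure_CI[of _ n]) (simp_all add: prod_emb_id[OF sets.sets_into_space[OF X, unfolded space_PiM]])
  qed
  have coord: "(\<lambda>\<omega>. \<omega> n) \<in> PiM {0..<Suc n} (\<lambda>_. ?T) \<rightarrow>\<^sub>M ?T" for n
    by (rule measurable_component_singleton) simp
  have m1: "marginal f x n = distr (C 0 (Suc n) ?u) ?T (\<lambda>\<omega>. \<omega> n)" for n
  proof -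
    have "marginal f x n = distr (process m f x) ?T ((\<lambda>\<omega>. \<omega> n) \<circ> (\<lambda>\<omega>. restrict \<omega> {0..<Suc n}))"
      unfolding marginal_def by (intro distr_cong) auto
    also have "\<dots> = distr (distr PF.lim (PiM {0..<Suc n} (\<lambda>_. ?T)) (\<lambda>\<omega>. restrict \<omega> {0..<Suc n})) ?T (\<lambda>\<omega>. \<omega> n)"
      unfolding process_def
      by (rule distr_distr[symmetric, OF coord])
         (auto simp: measurable_cong_sets[OF PF.sets_lim] intro!: measurable_restrict)
    finally show ?thesis by (simp add: distr_lim CI)
  qed
  have C_space: "C 0 n ?u \<in> space (subprob_algebra (PiM {0..<n} (\<lambda>_. ?T)))" for n
    using measurable_space[OF measurable_C[of 0 n] u] by simp
  have ne: "space (C 0 n ?u) \<noteq> {}" for n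
    by (rule prob_space.not_empty[OF prob_space_C[OF u]])
  have eq_C: "eP n \<in> C 0 n ?u \<rightarrow>\<^sub>M subprob_algebra (PiM {0..<Suc n} (\<lambda>_. ?T))" for n
    using measurable_eP[of n] by (simp add: measurable_cong_sets[OF sets_C[OF u] refl])
  have m2: "marginal f x n = C 0 n ?u \<bind> step m f x n" for n
  proof -
    have "marginal f x n = C 0 n ?u \<bind> (\<lambda>\<omega>. distr (eP n \<omega>) ?T (\<lambda>\<omega>. \<omega> n))"
      unfolding m1 using distr_bind[OF eq_C ne coord] by simp
    also have "\<dots> = C 0 n ?u \<bind> step m f x n"
    proof (rule bind_cong[OF refl])
      fix \<omega> assume "\<omega> \<in> space (C 0 n ?u)"
      then have \<omega>: "\<omega> \<in> space (PiM {0..<n} (\<lambda>_. ?T))" by (simp add: space_C[OF u])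
      have "distr (eP n \<omega>) ?T (\<lambda>\<omega>. \<omega> n) = distr (step m f x n \<omega>) ?T ((\<lambda>\<omega>. \<omega> n) \<circ> fun_upd \<omega> n)"
        unfolding eP_def
        by (rule distr_distr[OF coord])
           (use \<omega> in \<open>auto intro!: measurable_fun_upd[where J="{0..<n}"] simp: sets_P measurable_cong_sets[OF sets_P[OF \<omega>] refl]\<close>)
      also have "\<dots> = distr (step m f x n \<omega>) (step m f x n \<omega>) (\<lambda>y. y)"
        by (rule distr_cong) (use sets_P[OF \<omega>] in auto)
      finally show "distr (eP n \<omega>) ?T (\<lambda>\<omega>. \<omega> n) = step m f x n \<omega>" by (simp add: distr_id2)
    qed
    finally show ?thesis .
  qed
  show "marginal f x 0 = return ?T (0, x)"
    unfolding m2 C.simps using bind_return[OF P[of 0] u] by simp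
  have "marginal f x (Suc n) = C 0 (Suc n) ?u \<bind> (\<lambda>\<omega>. step_kernel f (\<omega> n))"
    unfolding m2 step_Suc[abs_def] ..
  also have "\<dots> = distr (C 0 (Suc n) ?u) ?T (\<lambda>\<omega>. \<omega> n) \<bind> step_kernel f"
  proof (rule bind_distr[symmetric])
    show "(\<lambda>\<omega>. \<omega> n) \<in> C 0 (Suc n) ?u \<rightarrow>\<^sub>M ?T"
      using coord by (simp add: measurable_cong_sets[OF sets_C[OF u] refl] del: C.simps)
    show "step_kernel f \<in> ?T \<rightarrow>\<^sub>M subprob_algebra ?T"
      by (rule measurable_prob_algebraD[OF measurable_step_kernel[OF f]])
    show "space (C 0 (Suc n) ?u) \<noteq> {}" by (rule ne)
  qed
  also have "\<dots> = marginal f x n \<bind> step_kernel f" unfolding m1 ..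
  finally show "marginal f x (Suc n) = marginal f x n \<bind> step_kernel f" .
qed

end

section \<open>Expectations along the process\<close>

text \<open>Fubini's theorem for kernels, reduced to its version for nonnegative functions by adding
  the bound \<open>B\<close>.\<close>
lemma integral_bind_bounded:
  fixes \<psi> :: "'b \<Rightarrow> real"
  assumes M: "M \<in> space (prob_algebra N)" and K: "K \<in> N \<rightarrow>\<^sub>M prob_algebra R"
    and \<psi>: "\<psi> \<in> borel_measurable R" and bound: "\<And>y. y \<in> space R \<Longrightarrow> \<bar>\<psi> y\<bar> \<le> B"
  shows "(\<integral>y. \<psi> y \<partial>(M \<bind> K)) = (\<integral>x. (\<integral>y. \<psi> y \<partial>K x) \<partial>M)"
proof -
  have sM: "sets M = sets N" and pM: "prob_space M" using M by (auto simp: space_prob_algebra)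
  interpret M: prob_space M by fact
  have K': "K \<in> M \<rightarrow>\<^sub>M prob_algebra R" using K by (simp add: measurable_cong_sets[OF sM refl])
  have pK: "prob_space (K x)" "sets (K x) = sets R" if "x \<in> space M" for x
    using measurable_space[OF K' that] by (auto simp: space_prob_algebra)
  have bind: "M \<bind> K \<in> space (prob_algebra R)"
    using prob_space_bind'[OF M K] sets_bind'[OF M K] by (simp add: space_prob_algebra)
  have shift: "integrable Q \<psi>" "(\<integral>\<^sup>+ y. ennreal (\<psi> y + B) \<partial>Q) = ennreal ((\<integral>y. \<psi> y \<partial>Q) + B)"
    "\<bar>\<integral>y. \<psi> y \<partial>Q\<bar> \<le> B"
    if Q: "prob_space Q" "sets Q = sets R" for Q
  proof -
    interpret Q: prob_space Q by fact
    have sp: "space Q = space R" by (rule sets_eq_imp_space_eq[OF Q(2)])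
    have m: "\<psi> \<in> borel_measurable Q" using \<psi> by (simp add: measurable_cong_sets[OF Q(2) refl])
    show int: "integrable Q \<psi>"
      by (rule Q.integrable_const_bound[where B=B]) (use bound sp m in auto)
    have nonneg: "\<And>y. y \<in> space Q \<Longrightarrow> 0 \<le> \<psi> y + B" using bound sp by (force simp: abs_le_iff)
    have "(\<integral>\<^sup>+ y. ennreal (\<psi> y + B) \<partial>Q) = ennreal (\<integral>y. \<psi> y + B \<partial>Q)"
      by (rule nn_integral_eq_integral) (use int nonneg in auto)
    then show "(\<integral>\<^sup>+ y. ennreal (\<psi> y + B) \<partial>Q) = ennreal ((\<integral>y. \<psi> y \<partial>Q) + B)"
      using int by (simp add: Q.prob_space)
    have "(\<integral>y. \<psi> y \<partial>Q) \<le> (\<integral>y. B \<partial>Q)" "(\<integral>y. - B \<partial>Q) \<le> (\<integral>y. \<psi> y \<partial>Q)"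
      by (intro integral_mono int; use bound sp in \<open>force simp: abs_le_iff\<close>)+
    then show "\<bar>\<integral>y. \<psi> y \<partial>Q\<bar> \<le> B" by (simp add: Q.prob_space)
  qed
  have meas: "(\<lambda>x. \<integral>y. \<psi> y \<partial>K x) \<in> borel_measurable M"
    by (rule measurable_compose[OF measurable_prob_algebraD[OF K'] integral_measurable_subprob_algebra[OF \<psi>]])
  have int: "integrable M (\<lambda>x. \<integral>y. \<psi> y \<partial>K x)"
    by (rule M.integrable_const_bound[where B=B]) (use shift(3) pK meas in auto)
  have nonneg: "0 \<le> (\<integral>y. \<psi> y \<partial>K x) + B" if "x \<in> space M" for x
    using shift(3)[OF pK[OF that]] by linarith
  have b: "prob_space (M \<bind> K)" "sets (M \<bind> K) = sets R" using bind by (auto simp: space_prob_algebra)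
  have "ennreal ((\<integral>y. \<psi> y \<partial>(M \<bind> K)) + B) = (\<integral>\<^sup>+ y. ennreal (\<psi> y + B) \<partial>(M \<bind> K))"
    using shift(2)[OF b] by simp
  also have "\<dots> = (\<integral>\<^sup>+ x. (\<integral>\<^sup>+ y. ennreal (\<psi> y + B) \<partial>K x) \<partial>M)"
    by (rule nn_integral_bind[OF _ measurable_prob_algebraD[OF K']]) (use \<psi> in measurable)
  also have "\<dots> = (\<integral>\<^sup>+ x. ennreal ((\<integral>y. \<psi> y \<partial>K x) + B) \<partial>M)"
    by (rule nn_integral_cong) (use shift(2) pK in auto)
  also have "\<dots> = ennreal (\<integral>x. (\<integral>y. \<psi> y \<partial>K x) + B \<partial>M)"
    by (rule nn_integral_eq_integral) (use int nonneg in auto)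
  also have "(\<integral>x. (\<integral>y. \<psi> y \<partial>K x) + B \<partial>M) = (\<integral>x. (\<integral>y. \<psi> y \<partial>K x) \<partial>M) + B"
    using int by (simp add: M.prob_space)
  finally have eq: "ennreal ((\<integral>y. \<psi> y \<partial>(M \<bind> K)) + B) = ennreal ((\<integral>x. (\<integral>y. \<psi> y \<partial>K x) \<partial>M) + B)" .
  have "0 \<le> (\<integral>x. (\<integral>y. \<psi> y \<partial>K x) + B \<partial>M)"
    by (rule integral_nonneg_AE) (use nonneg in auto)
  then have "0 \<le> (\<integral>x. (\<integral>y. \<psi> y \<partial>K x) \<partial>M) + B"
    using int by (simp add: M.prob_space)
  moreover have "0 \<le> (\<integral>y. \<psi> y \<partial>(M \<bind> K)) + B" using shift(3)[OF b] by linarith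
  ultimately show ?thesis using eq by (simp add: ennreal_inj)
qed

context maintenance_model
begin

lemma transition_law_prob:
  assumes x: "x \<in> state_space m"
  shows "transition_law m x a \<in> space (prob_algebra (timed_stateM m))"
proof -
  have K: "(\<lambda>k. next_law m k (residual m x)) \<in> count_space UNIV \<rightarrow>\<^sub>M prob_algebra (timed_stateM m)"
    using prob_space_next_law residual_pos[OF tau_pos x] by (auto simp: space_prob_algebra)
  have M: "measure_pmf (after m x a) \<in> space (prob_algebra (count_space UNIV))"
    by (simp add: space_prob_algebra measure_pmf.prob_space_axioms)
  show ?thesis
    unfolding transition_law_def using prob_space_bind'[OF M K] sets_bind'[OF M K]
    by (simp add: space_prob_algebra)
qed

lemma nn_integral_transition_law:
  assumes x: "x \<in> state_space m" and H: "H \<in> borel_measurable (timed_stateM m)"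
  shows "(\<integral>\<^sup>+ w. H w \<partial>transition_law m x a) = (\<integral>\<^sup>+ k. next_integral k (residual m x) H \<partial>measure_pmf (after m x a))"
proof -
  have r: "0 < residual m x" "residual m x \<le> tau m" using residual_pos[OF tau_pos x] by auto
  have "(\<integral>\<^sup>+ w. H w \<partial>transition_law m x a)
      = (\<integral>\<^sup>+ k. (\<integral>\<^sup>+ w. H w \<partial>next_law m k (residual m x)) \<partial>measure_pmf (after m x a))"
    unfolding transition_law_def
    by (rule nn_integral_bind[OF H])
       (auto simp: space_subprob_algebra prob_space_imp_subprob_space prob_space_next_law[OF r])
  then show ?thesis by (simp add: nn_integral_next_law[OF r H])
qed

lemma measurable_time [measurable]: "fst \<in> borel_measurable (timed_stateM m)"
  and measurable_state [measurable]: "snd \<in> timed_stateM m \<rightarrow>\<^sub>M stateM m"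
  unfolding timed_stateM_def by simp_all

lemma AE_transition_law:
  assumes x: "x \<in> state_space m"
  shows "AE w in transition_law m x a. 0 < fst w \<and> fst w \<le> tau m"
proof -
  have r: "0 < residual m x" "residual m x \<le> tau m" using residual_pos[OF tau_pos x] by auto
  have P: "Measurable.pred (timed_stateM m) (\<lambda>w. 0 < fst w \<and> fst w \<le> tau m)" by measurable
  have K: "(\<lambda>k. next_law m k (residual m x)) \<in> measure_pmf (after m x a) \<rightarrow>\<^sub>M subprob_algebra (timed_stateM m)"
    by (auto simp: space_subprob_algebra prob_space_imp_subprob_space prob_space_next_law[OF r])
  show ?thesis
    unfolding transition_law_def by (subst AE_bind[OF K P]) (use AE_next_law[OF r] in auto)
qed

definition mean_sojourn :: "policy \<Rightarrow> state \<Rightarrow> real" where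
  "mean_sojourn f x = (\<integral>w. fst w \<partial>transition_law m x (f x))"

definition mean_next :: "policy \<Rightarrow> (state \<Rightarrow> real) \<Rightarrow> state \<Rightarrow> real" where
  "mean_next f h x = (\<integral>w. h (snd w) \<partial>transition_law m x (f x))"

lemma integrable_sojourn:
  assumes x: "x \<in> state_space m"
  shows "integrable (transition_law m x a) fst"
proof -
  have "sets (transition_law m x a) = sets (timed_stateM m)"
    using transition_law_prob[OF x] by (simp add: space_prob_algebra)
  note [simp] = measurable_cong_sets[OF this refl]
  interpret prob_space "transition_law m x a" using transition_law_prob[OF x] by (simp add: space_prob_algebra)
  show ?thesis
  proof (rule integrable_const_bound[where B="tau m"])
    show "AE w in transition_law m x a. norm (fst w) \<le> tau m"
      using AE_transition_law[OF x, of a] by (rule eventually_mono) auto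
  qed auto
qed

lemma integrable_next:
  fixes h :: "state \<Rightarrow> real"
  assumes x: "x \<in> state_space m" and h: "h \<in> borel_measurable (stateM m)"
    and B: "\<And>y. y \<in> state_space m \<Longrightarrow> \<bar>h y\<bar> \<le> B"
  shows "integrable (transition_law m x a) (\<lambda>w. h (snd w))"
proof -
  have s: "sets (transition_law m x a) = sets (timed_stateM m)"
    using transition_law_prob[OF x] by (simp add: space_prob_algebra)
  note [simp] = measurable_cong_sets[OF s refl] sets_eq_imp_space_eq[OF s]
  interpret prob_space "transition_law m x a" using transition_law_prob[OF x] by (simp add: space_prob_algebra)
  have "(\<lambda>w. h (snd w)) \<in> borel_measurable (timed_stateM m)" using h by measurable
  then show ?thesis
    using B by (intro integrable_const_bound[where B=B]) (auto simp: space_timed_stateM)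
qed

lemma mean_sojourn_bounds:
  assumes x: "x \<in> state_space m"
  shows "0 \<le> mean_sojourn f x" "mean_sojourn f x \<le> tau m"
proof -
  interpret prob_space "transition_law m x (f x)" using transition_law_prob[OF x] by (simp add: space_prob_algebra)
  show "0 \<le> mean_sojourn f x"
    unfolding mean_sojourn_def using AE_transition_law[OF x, of "f x"] by (intro integral_nonneg_AE) (auto elim: eventually_mono)
  have "mean_sojourn f x \<le> (\<integral>w. tau m \<partial>transition_law m x (f x))"
    unfolding mean_sojourn_def using AE_transition_law[OF x, of "f x"]
    by (intro integral_mono_AE integrable_sojourn x) (auto elim: eventually_mono)
  then show "mean_sojourn f x \<le> tau m" by (simp add: prob_space)
qed

lemma mean_next_bound:
  fixes h :: "state \<Rightarrow> real"
  assumes x: "x \<in> state_space m" and h: "h \<in> borel_measurable (stateM m)"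
    and B: "\<And>y. y \<in> state_space m \<Longrightarrow> \<bar>h y\<bar> \<le> B"
  shows "\<bar>mean_next f h x\<bar> \<le> B"
proof -
  interpret prob_space "transition_law m x (f x)" using transition_law_prob[OF x] by (simp add: space_prob_algebra)
  have s: "space (transition_law m x (f x)) = space (timed_stateM m)"
    using transition_law_prob[OF x] by (intro sets_eq_imp_space_eq) (simp add: space_prob_algebra)
  have "mean_next f h x \<le> (\<integral>w. B \<partial>transition_law m x (f x))" "(\<integral>w. - B \<partial>transition_law m x (f x)) \<le> mean_next f h x"
    unfolding mean_next_def
    by (intro integral_mono integrable_next[OF x h B]; use B in \<open>force simp: s space_timed_stateM abs_le_iff\<close>)+
  then show ?thesis by (simp add: prob_space)
qed

lemma measurable_mean_sojourn:
  assumes f: "f \<in> policies m"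
  shows "mean_sojourn f \<in> borel_measurable (stateM m)"
  unfolding mean_sojourn_def
  by (rule measurable_compose[OF measurable_prob_algebraD[OF measurable_transition_law[OF f]]
        integral_measurable_subprob_algebra]) measurable

lemma measurable_mean_next:
  assumes f: "f \<in> policies m" and h [measurable]: "h \<in> borel_measurable (stateM m)"
  shows "mean_next f h \<in> borel_measurable (stateM m)"
  unfolding mean_next_def
  by (rule measurable_compose[OF measurable_prob_algebraD[OF measurable_transition_law[OF f]]
        integral_measurable_subprob_algebra]) measurable

lemma marginal_prob:
  assumes f: "f \<in> policies m" and x: "x \<in> state_space m"
  shows "marginal f x n \<in> space (prob_algebra (timed_stateM m))"
proof (induction n)
  case 0
  show ?case
    using x by (simp add: marginal_0[OF f x] space_prob_algebra prob_space_return space_timed_stateM)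
next
  case (Suc n)
  show ?case
    unfolding marginal_Suc[OF f x]
    using prob_space_bind'[OF Suc measurable_step_kernel[OF f]] sets_bind'[OF Suc measurable_step_kernel[OF f]]
    by (simp add: space_prob_algebra)
qed

lemma
  assumes f: "f \<in> policies m" and x: "x \<in> state_space m"
  shows sets_marginal: "sets (marginal f x n) = sets (timed_stateM m)"
    and space_marginal: "space (marginal f x n) = UNIV \<times> state_space m"
    and prob_space_marginal: "prob_space (marginal f x n)"
proof -
  show *: "sets (marginal f x n) = sets (timed_stateM m)"
    using marginal_prob[OF f x, of n] by (simp add: space_prob_algebra)
  show "space (marginal f x n) = UNIV \<times> state_space m"
    unfolding sets_eq_imp_space_eq[OF *] by (rule space_timed_stateM)
  show "prob_space (marginal f x n)"
    using marginal_prob[OF f x, of n] by (simp add: space_prob_algebra)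
qed

lemma integrable_marginal:
  fixes h :: "state \<Rightarrow> real"
  assumes f: "f \<in> policies m" and x: "x \<in> state_space m" and h: "h \<in> borel_measurable (stateM m)"
    and B: "\<And>y. y \<in> state_space m \<Longrightarrow> \<bar>h y\<bar> \<le> B"
  shows "integrable (marginal f x n) (\<lambda>z. h (snd z) :: real)"
proof -
  interpret prob_space "marginal f x n" by (rule prob_space_marginal[OF f x])
  have "(\<lambda>w. h (snd w)) \<in> borel_measurable (timed_stateM m)" using h by measurable
  then show ?thesis using B
    by (intro integrable_const_bound[where B=B])
       (auto simp: space_marginal[OF f x] measurable_cong_sets[OF sets_marginal[OF f x] refl])
qed

lemma measurable_translate: "z \<in> space (timed_stateM m) \<Longrightarrow>
    (\<lambda>w. (fst z + fst w, snd w)) \<in> timed_stateM m \<rightarrow>\<^sub>M timed_stateM m"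
  using measurable_compose[OF measurable_Pair1' measurable_shift, of z] by (simp add: case_prod_beta')

lemma integral_step_kernel:
  fixes \<psi> :: "real \<times> state \<Rightarrow> real"
  assumes z: "z \<in> space (timed_stateM m)" and \<psi>: "\<psi> \<in> borel_measurable (timed_stateM m)"
  shows "(\<integral>w. \<psi> w \<partial>step_kernel f z) = (\<integral>w. \<psi> (fst z + fst w, snd w) \<partial>transition_law m (snd z) (f (snd z)))"
proof -
  have x: "snd z \<in> state_space m" using z by (auto simp: space_timed_stateM)
  have s: "sets (transition_law m (snd z) (f (snd z))) = sets (timed_stateM m)"
    using transition_law_prob[OF x] by (simp add: space_prob_algebra)
  show ?thesis
    unfolding step_kernel_def case_prod_beta'
    by (rule integral_distr) (use \<psi> measurable_translate[OF z] in \<open>simp_all add: measurable_cong_sets[OF s refl]\<close>)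
qed

lemma expectation_next_state:
  fixes h :: "state \<Rightarrow> real"
  assumes f: "f \<in> policies m" and x: "x \<in> state_space m" and h: "h \<in> borel_measurable (stateM m)"
    and B: "\<And>y. y \<in> state_space m \<Longrightarrow> \<bar>h y\<bar> \<le> B"
  shows "(\<integral>z. h (snd z) \<partial>marginal f x (Suc n)) = (\<integral>z. mean_next f h (snd z) \<partial>marginal f x n)"
proof -
  have hm: "(\<lambda>w. h (snd w)) \<in> borel_measurable (timed_stateM m)" using h by measurable
  have "(\<integral>z. h (snd z) \<partial>marginal f x (Suc n)) = (\<integral>z. (\<integral>w. h (snd w) \<partial>step_kernel f z) \<partial>marginal f x n)"
    unfolding marginal_Suc[OF f x]
    by (rule integral_bind_bounded[OF marginal_prob[OF f x] measurable_step_kernel[OF f] hm])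
       (use B in \<open>auto simp: space_timed_stateM\<close>)
  also have "\<dots> = (\<integral>z. mean_next f h (snd z) \<partial>marginal f x n)"
    by (rule Bochner_Integration.integral_cong)
       (auto simp: space_marginal[OF f x] space_timed_stateM integral_step_kernel[OF _ hm] mean_next_def)
  finally show ?thesis .
qed

lemma AE_epoch_bounds:
  assumes f: "f \<in> policies m" and x: "x \<in> state_space m"
  shows "AE z in marginal f x n. 0 \<le> fst z \<and> fst z \<le> real n * tau m"
proof (induction n)
  case 0
  show ?case unfolding marginal_0[OF f x]
    by (subst AE_return) (use x in \<open>auto simp: space_timed_stateM\<close>)
next
  case (Suc n)
  have P: "Measurable.pred (timed_stateM m) (\<lambda>z. 0 \<le> fst z \<and> fst z \<le> real (Suc n) * tau m)" by measurable
  have K: "step_kernel f \<in> marginal f x n \<rightarrow>\<^sub>M subprob_algebra (timed_stateM m)"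
    using measurable_prob_algebraD[OF measurable_step_kernel[OF f]]
    by (simp add: measurable_cong_sets[OF sets_marginal[OF f x] refl])
  show ?case
    unfolding marginal_Suc[OF f x]
  proof (subst AE_bind[OF K P], use Suc in \<open>rule AE_mp\<close>, rule AE_I2, rule impI)
    fix z assume "z \<in> space (marginal f x n)" and t: "0 \<le> fst z \<and> fst z \<le> real n * tau m"
    then have z: "z \<in> space (timed_stateM m)" and s: "snd z \<in> state_space m"
      by (auto simp: space_marginal[OF f x] space_timed_stateM)
    have ss: "sets (transition_law m (snd z) (f (snd z))) = sets (timed_stateM m)"
      using transition_law_prob[OF s] by (simp add: space_prob_algebra)
    have "AE w in transition_law m (snd z) (f (snd z)). 0 \<le> fst z + fst w \<and> fst z + fst w \<le> real (Suc n) * tau m"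
      using AE_transition_law[OF s] by (rule eventually_mono) (use t in \<open>auto simp: algebra_simps\<close>)
    then show "AE w in step_kernel f z. 0 \<le> fst w \<and> fst w \<le> real (Suc n) * tau m"
      unfolding step_kernel_def case_prod_beta'
      using measurable_translate[OF z] P
      by (subst AE_distr_iff) (auto simp: measurable_cong_sets[OF ss refl] pred_def)
  qed
qed

lemma integrable_epoch:
  assumes f: "f \<in> policies m" and x: "x \<in> state_space m"
  shows "integrable (marginal f x n) fst"
proof -
  interpret prob_space "marginal f x n" by (rule prob_space_marginal[OF f x])
  show ?thesis
    using AE_epoch_bounds[OF f x, of n]
    by (intro integrable_const_bound[where B="real n * tau m"])
       (auto simp: measurable_cong_sets[OF sets_marginal[OF f x] refl])
qed

text \<open>The epochs are unbounded as functions on the timed states, but almost surely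
  \<open>0 \<le> T\<^sub>n \<le> n \<tau>\<close>; clamping them to this range brings the bounded case into play.\<close>
lemma expectation_next_epoch:
  assumes f: "f \<in> policies m" and x: "x \<in> state_space m"
  shows "(\<integral>z. fst z \<partial>marginal f x (Suc n)) = (\<integral>z. fst z \<partial>marginal f x n) + (\<integral>z. mean_sojourn f (snd z) \<partial>marginal f x n)"
proof -
  define N where "N = real (Suc n) * tau m"
  define clamp where "clamp z = max 0 (min N (fst z))" for z :: "real \<times> state"
  have N: "0 \<le> N" unfolding N_def using tau_pos by simp
  have cm: "clamp \<in> borel_measurable (timed_stateM m)" unfolding clamp_def by measurable
  have ms: "integrable (marginal f x n) (\<lambda>z. mean_sojourn f (snd z))"
    by (rule integrable_marginal[OF f x measurable_mean_sojourn[OF f], where B="tau m"])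
       (use mean_sojourn_bounds in auto)
  have "(\<integral>z. fst z \<partial>marginal f x (Suc n)) = (\<integral>z. clamp z \<partial>marginal f x (Suc n))"
  proof (rule integral_cong_AE)
    show "AE z in marginal f x (Suc n). fst z = clamp z"
      using AE_epoch_bounds[OF f x, of "Suc n"] by (rule eventually_mono) (simp add: clamp_def N_def)
  qed (use cm in \<open>simp_all add: measurable_cong_sets[OF sets_marginal[OF f x] refl]\<close>)
  also have "\<dots> = (\<integral>z. (\<integral>w. clamp w \<partial>step_kernel f z) \<partial>marginal f x n)"
    unfolding marginal_Suc[OF f x]
    by (rule integral_bind_bounded[OF marginal_prob[OF f x] measurable_step_kernel[OF f] cm, where B=N])
       (use N in \<open>auto simp: clamp_def\<close>)
  also have "\<dots> = (\<integral>z. fst z + mean_sojourn f (snd z) \<partial>marginal f x n)"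
  proof (rule integral_cong_AE)
    show "(\<lambda>z. \<integral>w. clamp w \<partial>step_kernel f z) \<in> borel_measurable (marginal f x n)"
      using measurable_compose[OF measurable_prob_algebraD[OF measurable_step_kernel[OF f]]
          integral_measurable_subprob_algebra[OF cm]]
      by (simp add: measurable_cong_sets[OF sets_marginal[OF f x] refl])
    show "(\<lambda>z. fst z + mean_sojourn f (snd z)) \<in> borel_measurable (marginal f x n)"
      using borel_measurable_integrable[OF ms] borel_measurable_integrable[OF integrable_epoch[OF f x, of n]] by measurable
    show "AE z in marginal f x n. (\<integral>w. clamp w \<partial>step_kernel f z) = fst z + mean_sojourn f (snd z)"
      using AE_epoch_bounds[OF f x, of n]
    proof (rule AE_mp, intro AE_I2 impI)
      fix z assume "z \<in> space (marginal f x n)" and t: "0 \<le> fst z \<and> fst z \<le> real n * tau m"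
      then have z: "z \<in> space (timed_stateM m)" and s: "snd z \<in> state_space m"
        by (auto simp: space_marginal[OF f x] space_timed_stateM)
      let ?Q = "transition_law m (snd z) (f (snd z))"
      have ss: "sets ?Q = sets (timed_stateM m)"
        using transition_law_prob[OF s] by (simp add: space_prob_algebra)
      interpret Q: prob_space ?Q using transition_law_prob[OF s] by (simp add: space_prob_algebra)
      have "(\<integral>w. clamp w \<partial>step_kernel f z) = (\<integral>w. clamp (fst z + fst w, snd w) \<partial>?Q)"
        by (rule integral_step_kernel[OF z cm])
      also have "\<dots> = (\<integral>w. fst z + fst w \<partial>?Q)"
      proof (rule integral_cong_AE)
        show "(\<lambda>w. clamp (fst z + fst w, snd w)) \<in> borel_measurable ?Q"
          using measurable_compose[OF measurable_translate[OF z] cm] by (simp add: measurable_cong_sets[OF ss refl])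
        show "(\<lambda>w. fst z + fst w) \<in> borel_measurable ?Q"
          using measurable_time by (auto simp: measurable_cong_sets[OF ss refl])
        show "AE w in ?Q. clamp (fst z + fst w, snd w) = fst z + fst w"
          using AE_transition_law[OF s]
          by (rule eventually_mono) (use t in \<open>auto simp: clamp_def N_def algebra_simps\<close>)
      qed
      also have "\<dots> = fst z + mean_sojourn f (snd z)"
        unfolding mean_sojourn_def using integrable_sojourn[OF s] by (simp add: Q.prob_space)
      finally show "(\<integral>w. clamp w \<partial>step_kernel f z) = fst z + mean_sojourn f (snd z)" .
    qed
  qed
  also have "\<dots> = (\<integral>z. fst z \<partial>marginal f x n) + (\<integral>z. mean_sojourn f (snd z) \<partial>marginal f x n)"
    by (rule Bochner_Integration.integral_add[OF integrable_epoch[OF f x] ms])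
  finally show ?thesis .
qed

end

section \<open>The average cost optimality equation\<close>

context maintenance_model
begin

text \<open>The telescoped form of a one-step inequality. With the signs of \<open>h\<close>, \<open>c\<close> and \<open>g\<close> changed it
  also gives the reverse inequality, and with constant \<open>c\<close> it bounds the expected epochs.\<close>
lemma additive_functional_le:
  fixes h c :: "state \<Rightarrow> real"
  assumes f: "f \<in> policies m" and x: "x \<in> state_space m"
    and h: "h \<in> borel_measurable (stateM m)" and hB: "\<And>y. y \<in> state_space m \<Longrightarrow> \<bar>h y\<bar> \<le> B"
    and c: "c \<in> borel_measurable (stateM m)" and cB: "\<And>y. y \<in> state_space m \<Longrightarrow> \<bar>c y\<bar> \<le> B'"
    and ineq: "\<And>y. y \<in> state_space m \<Longrightarrow> h y \<le> c y - g * mean_sojourn f y + mean_next f h y"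
  shows "h x \<le> (\<Sum>k<n. \<integral>z. c (snd z) \<partial>marginal f x k) - g * (\<integral>z. fst z \<partial>marginal f x n)
     + (\<integral>z. h (snd z) \<partial>marginal f x n)"
proof (induction n)
  case 0
  have "(\<integral>z. h (snd z) \<partial>marginal f x 0) = h x" "(\<integral>z. fst z \<partial>marginal f x 0) = 0"
    unfolding marginal_0[OF f x] using x h
    by (subst integral_return; simp add: space_timed_stateM)+
  then show ?case by simp
next
  case (Suc n)
  have i: "integrable (marginal f x n) (\<lambda>z. c (snd z))" "integrable (marginal f x n) (\<lambda>z. h (snd z))"
    "integrable (marginal f x n) (\<lambda>z. mean_sojourn f (snd z))" "integrable (marginal f x n) (\<lambda>z. mean_next f h (snd z))"
    using mean_sojourn_bounds
    by (auto intro!: integrable_marginal[OF f x c cB] integrable_marginal[OF f x h hB]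
        integrable_marginal[OF f x measurable_mean_sojourn[OF f], of "tau m"]
        integrable_marginal[OF f x measurable_mean_next[OF f h] mean_next_bound[OF _ h hB]])
  have exp_next: "(\<integral>z. h (snd z) \<partial>marginal f x (Suc n)) = (\<integral>z. mean_next f h (snd z) \<partial>marginal f x n)"
    by (rule expectation_next_state[OF f x h hB])
  have "(\<integral>z. h (snd z) \<partial>marginal f x n)
      \<le> (\<integral>z. c (snd z) - g * mean_sojourn f (snd z) + mean_next f h (snd z) \<partial>marginal f x n)"
    by (rule integral_mono) (use i ineq in \<open>auto simp: space_marginal[OF f x]\<close>)
  also have "\<dots> = (\<integral>z. c (snd z) \<partial>marginal f x n) - g * (\<integral>z. mean_sojourn f (snd z) \<partial>marginal f x n)
      + (\<integral>z. h (snd z) \<partial>marginal f x (Suc n))"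
    using i exp_next by simp
  finally show ?case
    using Suc unfolding expectation_next_epoch[OF f x] by (simp add: algebra_simps)
qed

lemma integral_marginal_bound:
  fixes h :: "state \<Rightarrow> real"
  assumes f: "f \<in> policies m" and x: "x \<in> state_space m"
    and h: "h \<in> borel_measurable (stateM m)" and hB: "\<And>y. y \<in> state_space m \<Longrightarrow> \<bar>h y\<bar> \<le> B"
  shows "\<bar>\<integral>z. h (snd z) \<partial>marginal f x n\<bar> \<le> B"
proof -
  interpret prob_space "marginal f x n" by (rule prob_space_marginal[OF f x])
  have "(\<integral>z. h (snd z) \<partial>marginal f x n) \<le> (\<integral>z. B \<partial>marginal f x n)"
    "(\<integral>z. - B \<partial>marginal f x n) \<le> (\<integral>z. h (snd z) \<partial>marginal f x n)"
    by (intro integral_mono integrable_marginal[OF f x h hB]; use hB in \<open>force simp: space_marginal[OF f x] abs_le_iff\<close>)+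
  then show ?thesis by (simp add: prob_space)
qed

text \<open>A single sojourn can be arbitrarily short, namely when the next scheduled opportunity is
  near. But it then most likely ends at that opportunity, from where the next sojourn is
  long. The potential \<open>K\<close> on the states of type SO accounts for this: with \<open>\<beta>\<close> a
  lower bound of the probability that nothing happens before the next scheduled opportunity,
  elapsed time plus potential grows by at least \<open>\<beta> K\<close> per step on average, from every state. The
  value of \<open>K\<close> is chosen such that the loss of potential on leaving an SO state is
  outweighed by the gain in time.\<close>
lemma mean_epoch_unbounded:
  assumes f: "f \<in> policies m" and x: "x \<in> state_space m"
  shows "filterlim (\<lambda>n. \<integral>z. fst z \<partial>marginal f x n) at_top sequentially"
proof -
  define L where "L = max (event_rate Satisfactory) (event_rate Perfect)"
  define \<beta> where "\<beta> = exp (- L * tau m)"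
  define K where "K = \<beta> * tau m / 2"
  have L: "event_rate k \<le> L" for k by (cases k) (auto simp: L_def)
  have L0: "0 < L" using L[of Perfect] event_rate_pos[of Perfect] by linarith
  have \<beta>: "0 < \<beta>" "\<beta> \<le> 1" using L0 tau_pos by (auto simp: \<beta>_def)
  have K: "0 < K" using \<beta> tau_pos by (simp add: K_def)
  define h where "h y = (if fst (snd y) = SO then K else 0)" for y :: state
  have h: "h \<in> borel_measurable (stateM m)" unfolding h_def[abs_def] by measurable
  have hB: "\<bar>h y\<bar> \<le> K" for y using K by (simp add: h_def)
  have step: "\<beta> * (residual m y + K) \<le> mean_sojourn f y + mean_next f h y" if y: "y \<in> state_space m" for y
  proof -
    let ?Q = "transition_law m y (f y)" and ?r = "residual m y"
    have r: "0 < ?r" "?r \<le> tau m" using residual_pos[OF tau_pos y] by auto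
    have int: "integrable ?Q (\<lambda>w. fst w + h (snd w))"
      using integrable_sojourn[OF y] integrable_next[OF y h hB] by (rule Bochner_Integration.integrable_add)
    have pos: "AE w in ?Q. 0 \<le> fst w + h (snd w)"
      using AE_transition_law[OF y, of "f y"] by (rule eventually_mono) (use K in \<open>auto simp: h_def\<close>)
    have low: "ennreal (\<beta> * (?r + K)) \<le> next_integral k ?r (\<lambda>w. ennreal (fst w + h (snd w)))" for k
    proof -
      have "event_rate k * ?r \<le> L * tau m"
        using L[of k] r L0 by (intro mult_mono) auto
      then have "- L * tau m \<le> - event_rate k * ?r" by linarith
      then have "\<beta> \<le> exp (- event_rate k * ?r)" unfolding \<beta>_def by (simp only: exp_le_cancel_iff)
      then have "\<beta> * (?r + K) \<le> exp (- event_rate k * ?r) * (?r + K)"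
        using r K by (intro mult_right_mono) auto
      then have "ennreal (\<beta> * (?r + K)) \<le> ennreal (exp (- event_rate k * ?r)) * ennreal (?r + K)"
        using r K by (subst ennreal_mult[symmetric]) (auto intro: ennreal_leI)
      also have "\<dots> \<le> next_integral k ?r (\<lambda>w. ennreal (fst w + h (snd w)))"
        unfolding next_integral_def by (simp add: h_def)
      finally show ?thesis .
    qed
    have "ennreal (\<beta> * (?r + K)) = (\<integral>\<^sup>+ k. ennreal (\<beta> * (?r + K)) \<partial>measure_pmf (after m y (f y)))"
      by (simp add: measure_pmf.emeasure_space_1[simplified])
    also have "\<dots> \<le> (\<integral>\<^sup>+ k. next_integral k ?r (\<lambda>w. ennreal (fst w + h (snd w))) \<partial>measure_pmf (after m y (f y)))"
      by (intro nn_integral_mono low)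
    also have "\<dots> = (\<integral>\<^sup>+ w. ennreal (fst w + h (snd w)) \<partial>?Q)"
      by (rule nn_integral_transition_law[symmetric, OF y]) (use h in measurable)
    also have "\<dots> = ennreal (\<integral>w. fst w + h (snd w) \<partial>?Q)"
      by (rule nn_integral_eq_integral[OF int pos])
    also have "(\<integral>w. fst w + h (snd w) \<partial>?Q) = mean_sojourn f y + mean_next f h y"
      unfolding mean_sojourn_def mean_next_def
      by (rule Bochner_Integration.integral_add[OF integrable_sojourn[OF y] integrable_next[OF y h hB]])
    finally show ?thesis
      using integral_nonneg_AE[OF pos] \<beta> r K by (subst (asm) ennreal_le_iff) (auto simp: mean_sojourn_def mean_next_def
        Bochner_Integration.integral_add[OF integrable_sojourn[OF y] integrable_next[OF y h hB]])
  qed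
  have drift: "h y \<le> - (\<beta> * K) - (- 1) * mean_sojourn f y + mean_next f h y" if y: "y \<in> state_space m" for y
  proof -
    have r: "0 < residual m y" using residual_pos[OF tau_pos y] by auto
    have "h y + \<beta> * K \<le> \<beta> * (residual m y + K)"
    proof (cases "fst (snd y) = SO")
      case True
      then have "residual m y = tau m" by (cases y) auto
      moreover have "K + \<beta> * K \<le> \<beta> * (tau m + K)" using K by (simp add: K_def algebra_simps)
      ultimately show ?thesis using True by (simp add: h_def)
    qed (use r \<beta> in \<open>simp add: h_def\<close>)
    with step[OF y] show ?thesis by linarith
  qed
  have lower: "- 2 * K + real n * (\<beta> * K) \<le> (\<integral>z. fst z \<partial>marginal f x n)" for n
  proof -
    have "h x \<le> (\<Sum>k<n. \<integral>z. - (\<beta> * K) \<partial>marginal f x k) - (- 1) * (\<integral>z. fst z \<partial>marginal f x n)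
       + (\<integral>z. h (snd z) \<partial>marginal f x n)"
      by (rule additive_functional_le[OF f x h hB _ _ drift, where B'="\<beta> * K"]) (use \<beta> K in auto)
    then show ?thesis
      using integral_marginal_bound[OF f x h hB, of n] hB[of x]
      by (simp add: prob_space.prob_space[OF prob_space_marginal[OF f x]])
  qed
  have "filterlim (\<lambda>n. - 2 * K + real n * (\<beta> * K)) at_top sequentially"
    using \<beta> K by (intro filterlim_tendsto_add_at_top[OF tendsto_const]
        filterlim_at_top_mult_tendsto_pos[OF tendsto_const _ filterlim_real_sequentially]) auto
  then show ?thesis
    by (rule filterlim_at_top_mono) (use lower in auto)
qed

lemma average_cost_eq:
  assumes f: "f \<in> policies m" and x: "x \<in> state_space m"
  shows "average_cost m x f = limsup (\<lambda>n. ereal ((\<Sum>k<n. \<integral>z. cost m (snd z) (f (snd z)) \<partial>marginal f x k)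
     / (\<integral>z. fst z \<partial>marginal f x n)))"
    and measurable_policy_cost: "(\<lambda>y. cost m y (f y)) \<in> borel_measurable (stateM m)"
    and policy_cost_bound: "\<bar>cost m y (f y)\<bar> \<le> cost_so m + cost_uso m + cost_cm m"
proof -
  have "(\<lambda>y. cost m (fst y, fst (snd y), 0) (f y)) \<in> borel_measurable (stateM m)"
    by (rule measurable_discrete_data) (use f in \<open>auto simp: policies_def\<close>)
  also have "(\<lambda>y. cost m (fst y, fst (snd y), 0) (f y)) = (\<lambda>y. cost m y (f y))"
  proof
    show "cost m (fst y, fst (snd y), 0) (f y) = cost m y (f y)" for y
      by (cases y; cases "f y") auto
  qed
  finally show c: "(\<lambda>y. cost m y (f y)) \<in> borel_measurable (stateM m)" .
  show cB: "\<bar>cost m y (f y)\<bar> \<le> cost_so m + cost_uso m + cost_cm m" for y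
    using cost_so_nonneg cost_uso_nonneg cost_cm_nonneg by (cases y; cases "f y") auto
  note coord = measurable_coordinate_process[OF f x]
  have i: "integrable (marginal f x k) (\<lambda>z. cost m (snd z) (f (snd z)))" for k
    by (rule integrable_marginal[OF f x c cB])
  have "(\<integral>\<omega>. (\<Sum>k<n. cost m (state_at k \<omega>) (f (state_at k \<omega>))) \<partial>process m f x)
      = (\<Sum>k<n. \<integral>z. cost m (snd z) (f (snd z)) \<partial>marginal f x k)" for n
  proof -
    have mk: "(\<lambda>z. cost m (snd z) (f (snd z))) \<in> borel_measurable (timed_stateM m)"
      using measurable_compose[OF measurable_state c] .
    have "integrable (process m f x) (\<lambda>\<omega>. cost m (state_at k \<omega>) (f (state_at k \<omega>)))" for k
      using i[of k] unfolding marginal_def state_at_def by (subst (asm) integrable_distr_eq[OF coord mk])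
    then show ?thesis
      unfolding marginal_def by (simp add: integral_distr[OF coord mk] state_at_def)
  qed
  moreover have "(\<integral>\<omega>. epoch_time n \<omega> \<partial>process m f x) = (\<integral>z. fst z \<partial>marginal f x n)" for n
    unfolding marginal_def epoch_time_def by (simp add: integral_distr[OF coord measurable_time])
  ultimately show "average_cost m x f = limsup (\<lambda>n. ereal ((\<Sum>k<n. \<integral>z. cost m (snd z) (f (snd z)) \<partial>marginal f x k)
     / (\<integral>z. fst z \<partial>marginal f x n)))"
    unfolding average_cost_def by simp
qed

text \<open>A subsolution of the optimality equation for a given policy bounds its average cost from below
  and a supersolution bounds it from above: \<open>h\<close> is bounded, so its boundary terms
  vanish after division by the expected epoch.\<close>
lemma average_cost_ge:
  fixes h :: "state \<Rightarrow> real"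
  assumes f: "f \<in> policies m" and x: "x \<in> state_space m"
    and h: "h \<in> borel_measurable (stateM m)" and hB: "\<And>y. y \<in> state_space m \<Longrightarrow> \<bar>h y\<bar> \<le> B"
    and ineq: "\<And>y. y \<in> state_space m \<Longrightarrow> h y \<le> cost m y (f y) - g * mean_sojourn f y + mean_next f h y"
  shows "ereal g \<le> average_cost m x f"
proof -
  let ?T = "\<lambda>n. \<integral>z. fst z \<partial>marginal f x n"
  let ?C = "\<lambda>n. \<Sum>k<n. \<integral>z. cost m (snd z) (f (snd z)) \<partial>marginal f x k"
  note T = mean_epoch_unbounded[OF f x]
  have "((\<lambda>n. g - 2 * B / ?T n) \<longlongrightarrow> g - 0) sequentially"
    by (intro tendsto_intros real_tendsto_divide_at_top[OF tendsto_const T])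
  then have "g = limsup (\<lambda>n. ereal (g - 2 * B / ?T n))"
    using lim_imp_Limsup[OF sequentially_bot, of "\<lambda>n. ereal (g - 2 * B / ?T n)" "ereal g"] by simp
  also have "\<dots> \<le> limsup (\<lambda>n. ereal (?C n / ?T n))"
  proof (rule Limsup_mono)
    have "\<forall>\<^sub>F n in sequentially. 0 < ?T n" using T by (simp add: filterlim_at_top_dense)
    then show "\<forall>\<^sub>F n in sequentially. ereal (g - 2 * B / ?T n) \<le> ereal (?C n / ?T n)"
    proof (rule eventually_mono)
      fix n assume n: "0 < ?T n"
      have "h x \<le> ?C n - g * ?T n + (\<integral>z. h (snd z) \<partial>marginal f x n)"
        by (rule additive_functional_le[OF f x h hB measurable_policy_cost[OF f x] policy_cost_bound[OF f x] ineq])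
      then have "g * ?T n - 2 * B \<le> ?C n"
        using integral_marginal_bound[OF f x h hB, of n] hB[OF x] by linarith
      then have "(g * ?T n - 2 * B) / ?T n \<le> ?C n / ?T n" using n by (intro divide_right_mono) auto
      then show "ereal (g - 2 * B / ?T n) \<le> ereal (?C n / ?T n)" using n by (simp add: diff_divide_distrib)
    qed
  qed
  finally show ?thesis by (simp add: average_cost_eq[OF f x])
qed

lemma average_cost_le:
  fixes h :: "state \<Rightarrow> real"
  assumes f: "f \<in> policies m" and x: "x \<in> state_space m"
    and h: "h \<in> borel_measurable (stateM m)" and hB: "\<And>y. y \<in> state_space m \<Longrightarrow> \<bar>h y\<bar> \<le> B"
    and ineq: "\<And>y. y \<in> state_space m \<Longrightarrow> cost m y (f y) - g * mean_sojourn f y + mean_next f h y \<le> h y"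
  shows "average_cost m x f \<le> ereal g"
proof -
  let ?T = "\<lambda>n. \<integral>z. fst z \<partial>marginal f x n"
  let ?C = "\<lambda>n. \<Sum>k<n. \<integral>z. cost m (snd z) (f (snd z)) \<partial>marginal f x k"
  note T = mean_epoch_unbounded[OF f x]
  have "((\<lambda>n. g + 2 * B / ?T n) \<longlongrightarrow> g + 0) sequentially"
    by (intro tendsto_intros real_tendsto_divide_at_top[OF tendsto_const T])
  then have "limsup (\<lambda>n. ereal (g + 2 * B / ?T n)) = g"
    using lim_imp_Limsup[OF sequentially_bot, of "\<lambda>n. ereal (g + 2 * B / ?T n)" "ereal g"] by simp
  moreover have "limsup (\<lambda>n. ereal (?C n / ?T n)) \<le> limsup (\<lambda>n. ereal (g + 2 * B / ?T n))"
  proof (rule Limsup_mono)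
    have "\<forall>\<^sub>F n in sequentially. 0 < ?T n" using T by (simp add: filterlim_at_top_dense)
    then show "\<forall>\<^sub>F n in sequentially. ereal (?C n / ?T n) \<le> ereal (g + 2 * B / ?T n)"
    proof (rule eventually_mono)
      fix n assume n: "0 < ?T n"
      have "- h x \<le> (\<Sum>k<n. \<integral>z. - cost m (snd z) (f (snd z)) \<partial>marginal f x k) - (- g) * ?T n
          + (\<integral>z. - h (snd z) \<partial>marginal f x n)"
      proof (rule additive_functional_le[OF f x, where h="\<lambda>y. - h y" and c="\<lambda>y. - cost m y (f y)"])
        show "- h y \<le> - cost m y (f y) - - g * mean_sojourn f y + mean_next f (\<lambda>y. - h y) y"
          if "y \<in> state_space m" for y
          using ineq[OF that] by (simp add: mean_next_def)
      qed (use h hB measurable_policy_cost[OF f x] policy_cost_bound[OF f x] in auto)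
      then have "?C n \<le> g * ?T n + 2 * B"
        using integral_marginal_bound[OF f x h hB, of n] hB[OF x] by (simp add: sum_negf)
      then have "?C n / ?T n \<le> (g * ?T n + 2 * B) / ?T n" using n by (intro divide_right_mono) auto
      then show "ereal (?C n / ?T n) \<le> ereal (g + 2 * B / ?T n)" using n by (simp add: add_divide_distrib)
    qed
  qed
  ultimately show ?thesis by (simp add: average_cost_eq[OF f x])
qed

lemma optimal_if_optimality_equation:
  fixes h :: "state \<Rightarrow> real"
  assumes f: "f \<in> policies m"
    and h: "h \<in> borel_measurable (stateM m)" and hB: "\<And>y. y \<in> state_space m \<Longrightarrow> \<bar>h y\<bar> \<le> B"
    and eq: "\<And>y. y \<in> state_space m \<Longrightarrow> h y = cost m y (f y) + (\<integral>w. h (snd w) - g * fst w \<partial>transition_law m y (f y))"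
    and le: "\<And>y a. y \<in> state_space m \<Longrightarrow> a \<in> admissible y \<Longrightarrow>
      h y \<le> cost m y a + (\<integral>w. h (snd w) - g * fst w \<partial>transition_law m y a)"
  shows "optimal m f"
proof -
  have split: "(\<integral>w. h (snd w) - g * fst w \<partial>transition_law m y (k y)) = mean_next k h y - g * mean_sojourn k y"
    if y: "y \<in> state_space m" for y k
    unfolding mean_next_def mean_sojourn_def
    using integrable_sojourn[OF y] integrable_next[OF y h hB] by simp
  have lower: "ereal g \<le> average_cost m x k" if "x \<in> state_space m" "k \<in> policies m" for x k
  proof (rule average_cost_ge[OF that(2,1) h hB])
    fix y assume y: "y \<in> state_space m"
    then have "k y \<in> admissible y" using that(2) by (auto simp: policies_def)
    from le[OF y this] show "h y \<le> cost m y (k y) - g * mean_sojourn k y + mean_next k h y"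
      unfolding split[OF y] by simp
  qed
  have upper: "average_cost m x f \<le> ereal g" if "x \<in> state_space m" for x
    using split by (intro average_cost_le[OF f that h hB]) (simp_all add: eq)
  show ?thesis
    unfolding optimal_def
  proof (intro conjI f ballI antisym)
    fix x assume x: "x \<in> state_space m"
    show "average_cost m x f \<le> (INF k\<in>policies m. average_cost m x k)"
      using upper[OF x] lower[OF x] by (intro INF_greatest) (meson order_trans)
    show "(INF k\<in>policies m. average_cost m x k) \<le> average_cost m x f"
      by (rule INF_lower[OF f])
  qed
qed

end

section \<open>Relative values from the value difference\<close>

context maintenance_model
begin

text \<open>Evaluates the right-hand side of the optimality equation: once \<open>h\<close> and the post-action values
  \<open>v\<close> are linked by the backward equations, the expectation over the next transition
  collapses to the post-action value at the residual time.\<close>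
lemma transition_value:
  fixes h :: "state \<Rightarrow> real" and v :: "condition \<Rightarrow> real \<Rightarrow> real"
  assumes h: "h \<in> borel_measurable (stateM m)" and hB: "\<And>y. y \<in> state_space m \<Longrightarrow> \<bar>h y\<bar> \<le> B"
    and v_cont: "\<And>k. continuous_on {0..tau m} (v k)"
    and v_ode: "\<And>k t. 0 < t \<Longrightarrow> t < tau m \<Longrightarrow>
      (v k has_real_derivative
        rate m k * h (k, SC, t) + uso_rate m * h (k, USO, t) - event_rate k * v k t - g) (at t)"
    and v_0: "\<And>k. v k 0 = h (k, SO, 0)"
    and y: "y \<in> state_space m"
  shows "(\<integral>w. h (snd w) - g * fst w \<partial>transition_law m y a)
    = measure_pmf.expectation (after m y a) (\<lambda>k. v k (residual m y))"
proof -
  let ?Q = "transition_law m y a" and ?r = "residual m y" and ?P = "after m y a"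
  have r: "0 < ?r" "?r \<le> tau m" using residual_pos[OF tau_pos y] by auto
  \<comment> \<open>shifts the integrand to be nonnegative for all sojourn times up to \<open>tau m\<close>\<close>
  define C where "C = B + \<bar>g\<bar> * tau m"
  have nonneg: "0 \<le> C + h x - g * s" if "x \<in> state_space m" "0 < s" "s \<le> tau m" for x s
  proof -
    have "\<bar>g * s\<bar> \<le> \<bar>g\<bar> * tau m" using that by (simp add: abs_mult mult_left_mono)
    with hB[OF that(1)] show ?thesis by (simp add: C_def)
  qed
  have C0: "0 \<le> C + v k ?r" and val: "next_integral k ?r (\<lambda>w. ennreal (C + h (snd w) - g * fst w)) = ennreal (C + v k ?r)" for k
  proof -
    have S: "(k, SC, t) \<in> state_space m" "(k, USO, t) \<in> state_space m" if "0 < t" "t < tau m" for t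
      using that by (auto simp: state_space_def)
    have SO: "(k, SO, 0) \<in> state_space m" by (auto simp: state_space_def)
    have "next_integral k ?r (\<lambda>w. ennreal (C + h (snd w) - g * fst w)) = ennreal (C + v k ?r) \<and> 0 \<le> C + v k ?r"
    proof (rule next_integral_eq_value[OF r _ v_cont v_ode])
      show "(\<lambda>w. ennreal (C + h (snd w) - g * fst w)) \<in> borel_measurable (timed_stateM m)"
        using h by measurable
    qed (use r S SO nonneg in \<open>auto simp: v_0\<close>)
    then show "next_integral k ?r (\<lambda>w. ennreal (C + h (snd w) - g * fst w)) = ennreal (C + v k ?r)"
      "0 \<le> C + v k ?r" by auto
  qed
  have space_Q: "space ?Q = space (timed_stateM m)"
    using transition_law_prob[OF y] by (intro sets_eq_imp_space_eq) (simp add: space_prob_algebra)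
  interpret Q: prob_space ?Q using transition_law_prob[OF y] by (simp add: space_prob_algebra)
  have ih: "integrable ?Q (\<lambda>w. h (snd w))" by (rule integrable_next[OF y h hB])
  have fin: "finite (set_pmf ?P)"
    by (rule finite_subset[OF subset_UNIV]) (simp add: UNIV_condition)
  have int: "integrable ?Q (\<lambda>w. C + h (snd w) - g * fst w)"
    using integrable_sojourn[OF y] ih by simp
  have posQ: "AE w in ?Q. 0 \<le> C + h (snd w) - g * fst w"
    using AE_transition_law[OF y, of a]
    by (rule AE_mp) (use nonneg in \<open>auto simp: space_Q space_timed_stateM\<close>)
  have "ennreal (\<integral>w. C + h (snd w) - g * fst w \<partial>?Q) = (\<integral>\<^sup>+ w. ennreal (C + h (snd w) - g * fst w) \<partial>?Q)"
    by (rule nn_integral_eq_integral[symmetric, OF int posQ])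
  also have "\<dots> = (\<integral>\<^sup>+ k. next_integral k ?r (\<lambda>w. ennreal (C + h (snd w) - g * fst w)) \<partial>measure_pmf ?P)"
    by (rule nn_integral_transition_law[OF y]) (use h in measurable)
  also have "\<dots> = ennreal (\<integral>k. C + v k ?r \<partial>measure_pmf ?P)"
    unfolding val
    by (rule nn_integral_eq_integral) (use fin C0 in \<open>auto intro: integrable_measure_pmf_finite\<close>)
  finally have "(\<integral>w. C + h (snd w) - g * fst w \<partial>?Q) = (\<integral>k. C + v k ?r \<partial>measure_pmf ?P)"
    using integral_nonneg_AE[OF posQ] C0 by (subst (asm) ennreal_inj) (auto intro!: integral_nonneg_AE)
  moreover have "(\<integral>w. C + h (snd w) - g * fst w \<partial>?Q) = C + (\<integral>w. h (snd w) - g * fst w \<partial>?Q)"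
  proof -
    have "(\<integral>w. C + h (snd w) - g * fst w \<partial>?Q) = (\<integral>w. C + (h (snd w) - g * fst w) \<partial>?Q)"
      by (simp add: algebra_simps)
    also have "\<dots> = C + (\<integral>w. h (snd w) - g * fst w \<partial>?Q)"
      using integrable_sojourn[OF y, of a] ih by (subst Bochner_Integration.integral_add) (auto simp: Q.prob_space)
    finally show ?thesis .
  qed
  moreover have "(\<integral>k. C + v k ?r \<partial>measure_pmf ?P) = C + (\<integral>k. v k ?r \<partial>measure_pmf ?P)"
    using fin by (subst Bochner_Integration.integral_add) (auto intro: integrable_measure_pmf_finite)
  ultimately show ?thesis by simp
qed

lemma pm_policy_in_policies:
  assumes R: "R \<in> sets borel"
  shows "pm_policy b R \<in> policies m"
proof -
  have "(\<lambda>x. pm_policy b R (fst x, fst (snd x), snd (snd x))) \<in> stateM m \<rightarrow>\<^sub>M count_space UNIV"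
  proof (rule measurable_state_cases[where F="\<lambda>i j x. pm_policy b R (i, j, snd (snd x))"])
    fix i j
    have "Measurable.pred (stateM m) (\<lambda>x. snd (snd x) \<in> R)"
      using R by measurable
    then show "(\<lambda>x. pm_policy b R (i, j, snd (snd x))) \<in> stateM m \<rightarrow>\<^sub>M count_space UNIV"
      by (cases i; cases j) auto
  qed
  moreover have "pm_policy b R x \<in> admissible x" for x
  proof (cases x)
    case (fields i j t)
    then show ?thesis by (cases i; cases j) auto
  qed
  ultimately show ?thesis by (auto simp: policies_def)
qed

text \<open>The verification theorem in terms of the value difference \<open>\<Delta>\<close> alone. The value \<open>u\<close> of condition
  2 is recovered by integrating \<open>mu2 m * \<Delta> - g\<close>, and \<open>g\<close> is the one constant that makes \<open>u\<close>
  periodic, as it must be since the clock is reset at a scheduled opportunity.\<close>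
lemma optimal_pm_policy:
  assumes \<Delta>_cont: "continuous_on {0..tau m} \<Delta>"
    and \<Delta>_ode: "\<And>t. 0 < t \<Longrightarrow> t < tau m \<Longrightarrow>
      (\<Delta> has_real_derivative mu1 m * cost_cm m - (mu1 m + mu2 m) * \<Delta> t
         + uso_rate m * min 0 (cost_uso m - pr m * \<Delta> t)) (at t)"
    and \<Delta>_0: "\<Delta> 0 = \<Delta> (tau m) + min 0 (cost_so m - pr m * \<Delta> (tau m))"
    and b: "b \<Longrightarrow> cost_so m \<le> pr m * \<Delta> (tau m)" "\<not> b \<Longrightarrow> pr m * \<Delta> (tau m) \<le> cost_so m"
    and R: "R \<in> sets borel"
      "\<And>t. 0 < t \<Longrightarrow> t < tau m \<Longrightarrow> t \<in> R \<Longrightarrow> cost_uso m \<le> pr m * \<Delta> t"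
      "\<And>t. 0 < t \<Longrightarrow> t < tau m \<Longrightarrow> t \<notin> R \<Longrightarrow> pr m * \<Delta> t \<le> cost_uso m"
  shows "optimal m (pm_policy b R)"
proof -
  define g where "g = mu2 m * integral {0..tau m} \<Delta> / tau m"
  define u where "u t = integral {0..t} (\<lambda>s. mu2 m * \<Delta> s - g)" for t
  define v where "v k t = (case k of Perfect \<Rightarrow> u t | Satisfactory \<Rightarrow> u t + \<Delta> t)" for k t
  have v_simps: "v Perfect t = u t" "v Satisfactory t = u t + \<Delta> t" for t by (simp_all add: v_def)
  have cont: "continuous_on {0..tau m} (\<lambda>s. mu2 m * \<Delta> s - g)"
    using \<Delta>_cont by (intro continuous_intros)
  have u_within: "(u has_real_derivative mu2 m * \<Delta> t - g) (at t within {0..tau m})" if "t \<in> {0..tau m}" for t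
    unfolding u_def by (rule integral_has_real_derivative[OF cont that])
  have u_cont: "continuous_on {0..tau m} u"
    by (rule DERIV_continuous_on[OF u_within])
  have u_ode: "(u has_real_derivative mu2 m * \<Delta> t - g) (at t)" if "0 < t" "t < tau m" for t
    using u_within[of t] that by (simp add: at_within_Icc_at)
  have u_0: "u 0 = 0" by (simp add: u_def)
  have "u (tau m) = mu2 m * integral {0..tau m} \<Delta> - g * tau m"
    unfolding u_def using tau_pos integrable_continuous_real[OF \<Delta>_cont]
    by (subst integral_diff) (auto intro!: integrable_on_mult_right)
  then have u_tau: "u (tau m) = 0" using tau_pos by (simp add: g_def)

  \<comment> \<open>\<open>\<Delta>\<close> is known to be continuous on \<open>{0..tau m}\<close> only; clipping the clock makes \<open>h\<close> measurable\<close>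
  define clip where "clip t = max 0 (min (tau m) t)" for t :: real
  define H where "H i j t = (case j of
      SC \<Rightarrow> (case i of Perfect \<Rightarrow> u t + \<Delta> t | Satisfactory \<Rightarrow> cost_cm m + u t)
    | USO \<Rightarrow> (case i of Perfect \<Rightarrow> u t | Satisfactory \<Rightarrow> u t + \<Delta> t + min 0 (cost_uso m - pr m * \<Delta> t))
    | SO \<Rightarrow> v i 0)" for i j t
  define h where "h y = H (fst y) (fst (snd y)) (clip (snd (snd y)))" for y :: state
  have clip: "0 \<le> clip t" "clip t \<le> tau m" "0 \<le> t \<Longrightarrow> t \<le> tau m \<Longrightarrow> clip t = t" for t
    using tau_pos by (auto simp: clip_def)
  have h_simps: "h (Perfect, SC, t) = u t + \<Delta> t" "h (Satisfactory, SC, t) = cost_cm m + u t"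
    "h (Perfect, USO, t) = u t" "h (Satisfactory, USO, t) = u t + \<Delta> t + min 0 (cost_uso m - pr m * \<Delta> t)"
    "h (Perfect, SO, t) = u 0" "h (Satisfactory, SO, t) = u 0 + \<Delta> 0" if "0 \<le> t" "t \<le> tau m" for t
    using clip(3)[OF that] by (simp_all add: h_def H_def v_def)
  have clip_meas: "(\<lambda>t. w (clip t)) \<in> borel_measurable borel" if "continuous_on {0..tau m} w" for w :: "real \<Rightarrow> real"
  proof (rule borel_measurable_continuous_onI, rule continuous_on_compose2[OF that])
    show "continuous_on UNIV clip" unfolding clip_def by (intro continuous_intros)
  qed (use clip in auto)
  have h_meas: "h \<in> borel_measurable (stateM m)"
    unfolding h_def[abs_def]
  proof (rule measurable_state_cases[where F="\<lambda>i j y. H i j (clip (snd (snd y)))"])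
    fix i j
    have "(\<lambda>t. H i j (clip t)) \<in> borel_measurable borel"
      using clip_meas[OF u_cont] clip_meas[OF \<Delta>_cont] by (cases i; cases j) (auto simp: H_def)
    from measurable_compose[OF measurable_clock_stateM this]
    show "(\<lambda>y. H i j (clip (snd (snd y)))) \<in> borel_measurable (stateM m)" .
  qed
  have bounded: "\<exists>K. \<forall>t\<in>{0..tau m}. \<bar>w t\<bar> \<le> K" if "continuous_on {0..tau m} w" for w :: "real \<Rightarrow> real"
    using compact_imp_bounded[OF compact_continuous_image[OF that compact_Icc]] by (auto simp: bounded_iff)
  obtain B1 B2 where B1: "\<And>t. t \<in> {0..tau m} \<Longrightarrow> \<bar>\<Delta> t\<bar> \<le> B1" and B2: "\<And>t. t \<in> {0..tau m} \<Longrightarrow> \<bar>u t\<bar> \<le> B2"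
    using bounded[OF \<Delta>_cont] bounded[OF u_cont] by blast
  define B where "B = 2 * B2 + 3 * B1 + cost_cm m + cost_uso m"
  have hB: "\<bar>h y\<bar> \<le> B" for y
  proof -
    obtain i j t where y: "y = (i, j, t)" by (cases y)
    have 0: "\<bar>\<Delta> 0\<bar> \<le> B1" "\<bar>u 0\<bar> \<le> B2" using B1 B2 tau_pos by auto
    have t: "\<bar>\<Delta> (clip t)\<bar> \<le> B1" "\<bar>u (clip t)\<bar> \<le> B2" using B1 B2 clip by auto
    have "\<bar>pr m * \<Delta> (clip t)\<bar> \<le> 1 * B1"
      unfolding abs_mult using pr_nonneg pr_le_1 t by (intro mult_mono) auto
    then have "\<bar>min 0 (cost_uso m - pr m * \<Delta> (clip t))\<bar> \<le> cost_uso m + B1"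
      using cost_uso_nonneg by linarith
    moreover have "\<bar>h y\<bar> \<le> \<bar>u (clip t)\<bar> + \<bar>\<Delta> (clip t)\<bar> + \<bar>u 0\<bar> + \<bar>\<Delta> 0\<bar> + cost_cm m
        + \<bar>min 0 (cost_uso m - pr m * \<Delta> (clip t))\<bar>"
      using cost_cm_nonneg by (cases i; cases j) (auto simp: y h_def H_def v_def )
    ultimately show ?thesis using 0 t unfolding B_def by linarith
  qed
  have v_ode: "(v k has_real_derivative
        rate m k * h (k, SC, t) + uso_rate m * h (k, USO, t) - event_rate k * v k t - g) (at t)"
    if t: "0 < t" "t < tau m" for k t
  proof (cases k)
    case Perfect
    have "(u has_real_derivative mu2 m * (u t + \<Delta> t) + uso_rate m * u t - (uso_rate m + mu2 m) * u t - g) (at t)"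
      by (rule DERIV_cong[OF u_ode[OF t]]) (simp add: algebra_simps)
    then show ?thesis using t by (simp add: Perfect h_simps v_simps[abs_def])
  next
    case Satisfactory
    have "((\<lambda>t. u t + \<Delta> t) has_real_derivative mu1 m * (cost_cm m + u t)
        + uso_rate m * (u t + \<Delta> t + min 0 (cost_uso m - pr m * \<Delta> t)) - (uso_rate m + mu1 m) * (u t + \<Delta> t) - g) (at t)"
      by (rule DERIV_cong[OF DERIV_add[OF u_ode[OF t] \<Delta>_ode[OF t]]]) (simp add: algebra_simps)
    then show ?thesis using t by (simp add: Satisfactory h_simps v_simps[abs_def])
  qed
  have v_cont: "continuous_on {0..tau m} (v k)" for k
    by (cases k) (use u_cont \<Delta>_cont in \<open>auto simp: v_simps[abs_def] intro!: continuous_intros\<close>)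
  have v_0: "v k 0 = h (k, SO, 0)" for k
    by (simp add: h_def H_def)
  have bellman: "(\<integral>w. h (snd w) - g * fst w \<partial>transition_law m y a)
      = measure_pmf.expectation (after m y a) (\<lambda>k. v k (residual m y))" if "y \<in> state_space m" for y a
    by (rule transition_value[OF h_meas hB v_cont v_ode v_0 that])
  have h_SO: "h (Perfect, SO, 0) = u (tau m)"
    "h (Satisfactory, SO, 0) = u (tau m) + \<Delta> (tau m) + min 0 (cost_so m - pr m * \<Delta> (tau m))"
    using tau_pos \<Delta>_0 by (simp_all add: h_simps u_0 u_tau)
  show ?thesis
  proof (rule optimal_if_optimality_equation[OF pm_policy_in_policies[OF R(1)] h_meas hB, where g=g])
    fix y assume y: "y \<in> state_space m"
    obtain i j t where ijt: "y = (i, j, t)" by (cases y)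
    have jt: "j = SO \<and> t = 0 \<or> (j = SC \<or> j = USO) \<and> 0 < t \<and> t < tau m"
      using y by (auto simp: ijt state_space_def)
    show "h y = cost m y (pm_policy b R y) + (\<integral>w. h (snd w) - g * fst w \<partial>transition_law m y (pm_policy b R y))"
      unfolding bellman[OF y] using jt
      by (cases i; cases "t \<in> R"; cases b)
         (use b R(2)[of t] R(3)[of t] in \<open>auto simp: ijt h_simps h_SO v_simps pr_nonneg pr_le_1 min_def algebra_simps\<close>)
    fix a assume a: "a \<in> admissible y"
    show "h y \<le> cost m y a + (\<integral>w. h (snd w) - g * fst w \<partial>transition_law m y a)"
      unfolding bellman[OF y] using jt a cost_uso_nonneg cost_so_nonneg
      by (cases i; cases j)
         (auto simp: ijt h_simps h_SO v_simps pr_nonneg pr_le_1 algebra_simps)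
  qed
qed

end

section \<open>The value difference in closed form\<close>

locale imperfect_maintenance = maintenance_model +
  assumes pr_pos: "0 < pr m" and pr_less_1: "pr m < 1"
    and cost_so_less_uso: "cost_so m < cost_uso m"
begin

text \<open>The difference of the relative values of conditions 1 and 2 relaxes with rate \<open>rate_sum\<close> to
  \<open>rest_level\<close> if unscheduled opportunities are ignored, and with rate \<open>pm_rate\<close> to \<open>pm_level\<close> if they
  are used. Using them is worthwhile above \<open>break_even\<close>.\<close>

definition "rate_sum = mu1 m + mu2 m"
definition "pm_rate = rate_sum + uso_rate m * pr m"
definition "rest_level = mu1 m * cost_cm m / rate_sum"
definition "pm_level = (mu1 m * cost_cm m + uso_rate m * cost_uso m) / pm_rate"
definition "break_even = cost_uso m / pr m"

lemma rate_sum_pos: "0 < rate_sum"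
  using mu1_pos mu2_pos by (simp add: rate_sum_def)
lemma rate_sum_less_pm_rate: "rate_sum < pm_rate"
  using uso_rate_pos pr_pos by (simp add: pm_rate_def)
lemma pm_rate_pos: "0 < pm_rate"
  using rate_sum_pos rate_sum_less_pm_rate by simp
lemma rate_sum_rest_level: "rate_sum * rest_level = mu1 m * cost_cm m"
  using rate_sum_pos by (simp add: rest_level_def)
lemma pm_rate_pm_level: "pm_rate * pm_level = mu1 m * cost_cm m + uso_rate m * cost_uso m"
  using pm_rate_pos by (simp add: pm_level_def)
lemma pr_break_even: "pr m * break_even = cost_uso m"
  using pr_pos by (simp add: break_even_def)

text \<open>Both affine right-hand sides of the differential equation agree at the level
  \<open>break_even\<close>, where they switch. Hence \<open>pm_level\<close> lies on the same side of \<open>break_even\<close> as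
  \<open>rest_level\<close>, and a trajectory is differentiable where it crosses.\<close>
lemma level_excess: "pm_rate * (pm_level - break_even) = rate_sum * (rest_level - break_even)"
proof -
  have "pm_rate * (pm_level - break_even) = pm_rate * pm_level - (rate_sum + uso_rate m * pr m) * break_even"
    by (simp add: pm_rate_def algebra_simps)
  also have "\<dots> = rate_sum * rest_level - rate_sum * break_even"
    unfolding pm_rate_pm_level rate_sum_rest_level using pr_break_even by (simp add: algebra_simps)
  finally show ?thesis by (simp add: algebra_simps)
qed

text \<open>For \<open>0 \<le> t \<le> tau m\<close>, take the trajectory that crosses \<open>break_even\<close> at \<open>t\<close>, continued to \<open>0\<close>
  without and to \<open>tau m\<close> with unscheduled maintenance. Then \<open>so_gap t\<close> is its
  value at \<open>0\<close> minus the value \<open>cost_so m + (1 - pr m) * \<Delta> (tau m)\<close> that the boundary condition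
  demands. The threshold equation is \<open>so_gap t = 0\<close>.\<close>
definition so_gap :: "real \<Rightarrow> real" where
  "so_gap t = rest_level - cost_so m - (rest_level - break_even) * exp (rate_sum * t)
     - (1 - pr m) * pm_level + (1 - pr m) * (pm_level - break_even) * exp (pm_rate * (t - tau m))"

text \<open>By \<open>so_gap_tau\<close>, this says that \<open>so_gap (tau m)\<close> is negative. Equivalently, if unscheduled
  opportunities are never used and scheduled ones optimally, the value difference exceeds
  \<open>break_even\<close> right after a scheduled opportunity.\<close>
definition uso_profitable :: bool where
  "uso_profitable \<longleftrightarrow> cost_uso m - cost_so m < (rest_level - break_even) * (exp (rate_sum * tau m) - 1)"

lemma so_gap_tau:
  "so_gap (tau m) = cost_uso m - cost_so m - (rest_level - break_even) * (exp (rate_sum * tau m) - 1)"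
  using pr_break_even by (simp add: so_gap_def algebra_simps)

lemma exp_rate_sum_tau: "1 < exp (rate_sum * tau m)"
  using rate_sum_pos tau_pos by simp

lemma break_even_less_rest_if_profitable:
  assumes uso_profitable
  shows "break_even < rest_level"
proof -
  have "0 < (rest_level - break_even) * (exp (rate_sum * tau m) - 1)"
    using assms cost_so_less_uso by (simp add: uso_profitable_def)
  then show ?thesis using exp_rate_sum_tau zero_less_mult_pos2[of "rest_level - break_even"] by simp
qed

lemma break_even_less_pm_level:
  assumes "break_even < rest_level"
  shows "break_even < pm_level"
proof -
  have "0 < pm_rate * (pm_level - break_even)"
    unfolding level_excess using assms rate_sum_pos by simp
  then show ?thesis using pm_rate_pos by (simp add: zero_less_mult_iff)
qed

lemma continuous_so_gap: "continuous_on S so_gap"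
  unfolding so_gap_def[abs_def] by (intro continuous_intros)

text \<open>Up to the positive factor \<open>rate_sum * (rest_level - break_even)\<close>, the derivative is a difference
  of two exponentials, of which the one with the larger rate is still the smaller
  one as long as \<open>t \<le> tau m\<close>.\<close>
lemma so_gap_decreasing:
  assumes "break_even < rest_level" "s < t" "t \<le> tau m"
  shows "so_gap t < so_gap s"
proof (rule DERIV_neg_imp_decreasing[OF assms(2)])
  fix x assume x: "s \<le> x" "x \<le> t"
  let ?d = "rate_sum * (rest_level - break_even) * ((1 - pr m) * exp (pm_rate * (x - tau m)) - exp (rate_sum * x))"
  have "(so_gap has_real_derivative - (rest_level - break_even) * (exp (rate_sum * x) * rate_sum)
      + (1 - pr m) * (pm_level - break_even) * (exp (pm_rate * (x - tau m)) * pm_rate)) (at x)"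
    unfolding so_gap_def[abs_def] by (auto intro!: derivative_eq_intros simp: algebra_simps)
  moreover have "- (rest_level - break_even) * (exp (rate_sum * x) * rate_sum)
        + (1 - pr m) * (pm_level - break_even) * (exp (pm_rate * (x - tau m)) * pm_rate)
      = (1 - pr m) * exp (pm_rate * (x - tau m)) * (pm_rate * (pm_level - break_even))
        - exp (rate_sum * x) * (rate_sum * (rest_level - break_even))"
    by (simp add: algebra_simps)
  moreover have "\<dots> = ?d" unfolding level_excess by (simp add: algebra_simps)
  ultimately have "(so_gap has_real_derivative ?d) (at x)" by simp
  moreover have "?d < 0"
  proof -
    have "pm_rate * (x - tau m) \<le> rate_sum * (x - tau m)"
      using rate_sum_less_pm_rate x assms by (intro mult_right_mono_neg) auto
    also have "\<dots> \<le> rate_sum * x" using rate_sum_pos tau_pos by (simp add: algebra_simps)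
    finally have "exp (pm_rate * (x - tau m)) \<le> exp (rate_sum * x)" by simp
    then have "(1 - pr m) * exp (pm_rate * (x - tau m)) \<le> (1 - pr m) * exp (rate_sum * x)"
      using pr_less_1 by (intro mult_left_mono) auto
    also have "\<dots> < exp (rate_sum * x)" using pr_pos by simp
    finally show ?thesis using rate_sum_pos assms(1) by (intro mult_pos_neg) auto
  qed
  ultimately show "\<exists>y. DERIV so_gap x :> y \<and> y < 0" by blast
qed

text \<open>Far to the left, both exponentials are negligible and \<open>so_gap\<close> is positive, because
  \<open>break_even < pm_level < rest_level\<close> and \<open>cost_so m < pr m * break_even\<close>.\<close>
lemma ex_so_gap_root:
  assumes uso_profitable
  shows "\<exists>t < tau m. so_gap t = 0"
proof -
  have break_even_less_rest: "break_even < rest_level" by (rule break_even_less_rest_if_profitable[OF assms])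
  then have break_even_less_pm: "break_even < pm_level" by (rule break_even_less_pm_level)
  define \<kappa> where "\<kappa> = rest_level - cost_so m - (1 - pr m) * pm_level"
  have "pm_rate * pm_level = rate_sum * rest_level + uso_rate m * (pr m * break_even)" unfolding pm_rate_pm_level rate_sum_rest_level pr_break_even ..
  also have "\<dots> < rate_sum * rest_level + uso_rate m * (pr m * rest_level)"
    using break_even_less_rest pr_pos uso_rate_pos by simp
  also have "\<dots> = pm_rate * rest_level" by (simp add: pm_rate_def algebra_simps)
  finally have "pm_level < rest_level" using pm_rate_pos by simp
  moreover have "cost_so m < pr m * pm_level"
    using mult_strict_left_mono[OF break_even_less_pm pr_pos] pr_break_even cost_so_less_uso by simp
  ultimately have \<kappa>: "0 < \<kappa>" by (simp add: \<kappa>_def algebra_simps)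
  \<comment> \<open>so early that the first exponential term of \<open>so_gap s\<close> is at most \<open>\<kappa>\<close>\<close>
  define s where "s = min (tau m) (ln (\<kappa> / (rest_level - break_even)) / rate_sum)"
  have "rate_sum * s \<le> ln (\<kappa> / (rest_level - break_even))"
    using rate_sum_pos by (simp add: s_def min_def field_simps)
  then have "exp (rate_sum * s) \<le> \<kappa> / (rest_level - break_even)"
    using \<kappa> break_even_less_rest by (metis diff_gt_0_iff_gt divide_pos_pos exp_le_cancel_iff exp_ln)
  then have "(rest_level - break_even) * exp (rate_sum * s) \<le> \<kappa>" using break_even_less_rest by (simp add: field_simps)
  moreover have "0 \<le> (1 - pr m) * (pm_level - break_even) * exp (pm_rate * (s - tau m))"
    using pr_less_1 break_even_less_pm by simp
  ultimately have s: "0 \<le> so_gap s" by (simp add: so_gap_def \<kappa>_def)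
  have tau: "so_gap (tau m) < 0" using assms by (simp add: so_gap_tau uso_profitable_def)
  have "\<exists>t\<ge>s. t \<le> tau m \<and> so_gap t = 0"
    using s tau by (intro IVT2' continuous_so_gap) (auto simp: s_def)
  then show ?thesis using tau by (metis less_eq_real_def less_irrefl)
qed

text \<open>If \<open>rest_level\<close> exceeds \<open>break_even\<close>, monotonicity excludes roots before \<open>tau m\<close>; if both are
  equal, \<open>so_gap\<close> is a positive constant. If \<open>rest_level\<close> is smaller, there can be roots on both
  sides of \<open>tau m\<close>: now \<open>so_gap\<close> is nonnegative at \<open>tau m\<close> and tends to minus infinity, since
  the term with the larger rate \<open>pm_rate\<close> has a negative coefficient.\<close>
lemma so_gap_root_after_tau:
  assumes "\<not> uso_profitable" and root: "so_gap r = 0"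
  shows "\<exists>t \<ge> tau m. so_gap t = 0"
proof -
  have tau: "0 \<le> so_gap (tau m)" using assms by (simp add: so_gap_tau uso_profitable_def)
  consider "break_even < rest_level" | "rest_level = break_even" | "rest_level < break_even" by linarith
  then show ?thesis
  proof cases
    case 1
    have "\<not> r < tau m" using so_gap_decreasing[OF 1, of r "tau m"] tau root by auto
    then show ?thesis using root by (intro exI[of _ r]) auto
  next
    case 2
    then have "pm_rate * (pm_level - break_even) = 0" using level_excess by simp
    then have "pm_level = break_even" using pm_rate_pos by simp
    with 2 have "so_gap r = cost_uso m - cost_so m" using pr_break_even by (simp add: so_gap_def algebra_simps)
    then show ?thesis using root cost_so_less_uso by simp
  next
    case 3
    have "pm_rate * (pm_level - break_even) < 0" unfolding level_excess using 3 rate_sum_pos by (simp add: mult_pos_neg)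
    then have pm_less_break_even: "pm_level < break_even" using pm_rate_pos by (simp add: mult_less_0_iff)
    define \<kappa> where "\<kappa> = rest_level - cost_so m - (1 - pr m) * pm_level"
    \<comment> \<open>\<open>so_gap t\<close> is at most \<open>exp (rate_sum * t) * (b - c * exp (l * t))\<close> for \<open>t \<ge> 0\<close>\<close>
    define c where "c = (1 - pr m) * (break_even - pm_level) * exp (- pm_rate * tau m)"
    define b where "b = \<bar>\<kappa>\<bar> + (break_even - rest_level)"
    define l where "l = uso_rate m * pr m"
    have c: "0 < c" using pm_less_break_even pr_less_1 by (simp add: c_def)
    have b: "0 < b" using 3 by (simp add: b_def)
    have l: "0 < l" using uso_rate_pos pr_pos by (simp add: l_def)
    define t where "t = max (tau m) (ln (b / c) / l)"
    have "ln (b / c) \<le> l * t" using l by (simp add: t_def max_def field_simps)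
    then have "b / c \<le> exp (l * t)"
      using b c by (metis divide_pos_pos exp_le_cancel_iff exp_ln)
    then have bc: "b \<le> c * exp (l * t)" using c by (simp add: field_simps)
    have "0 \<le> t" using tau_pos by (simp add: t_def)
    then have "1 \<le> exp (rate_sum * t)" using rate_sum_pos by simp
    then have "\<bar>\<kappa>\<bar> * 1 \<le> \<bar>\<kappa>\<bar> * exp (rate_sum * t)" by (intro mult_left_mono) auto
    then have k: "\<kappa> \<le> \<bar>\<kappa>\<bar> * exp (rate_sum * t)" by simp
    have "exp (pm_rate * (t - tau m)) = exp (rate_sum * t) * exp (l * t) * exp (- pm_rate * tau m)"
      by (simp add: pm_rate_def l_def exp_add[symmetric] algebra_simps)
    then have "so_gap t = \<kappa> + (break_even - rest_level) * exp (rate_sum * t) - c * exp (l * t) * exp (rate_sum * t)"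
      by (simp add: so_gap_def \<kappa>_def c_def algebra_simps)
    also have "\<dots> \<le> (b - c * exp (l * t)) * exp (rate_sum * t)"
      using k by (simp add: b_def algebra_simps)
    also have "\<dots> \<le> 0" using bc by (intro mult_nonpos_nonneg) auto
    finally have "\<exists>x\<ge>tau m. x \<le> t \<and> so_gap x = 0"
      using tau by (intro IVT2' continuous_so_gap) (auto simp: t_def)
    then show ?thesis by auto
  qed
qed

text \<open>Without maintenance at scheduled opportunities either, the value difference is constantly
  \<open>rest_level\<close>. With it, \<open>\<Delta>\<close> increases from \<open>y\<close>, just before a scheduled opportunity, to its
  maximum \<open>z\<close>, just after one, so it suffices to compare \<open>z\<close> with the two prices.\<close>
lemma optimal_without_uso:
  assumes "\<not> uso_profitable"
  shows "optimal m (pm_policy (cost_so m < pr m * rest_level) {})"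
proof (cases "cost_so m < pr m * rest_level")
  case False
  show ?thesis
    by (rule optimal_pm_policy[where \<Delta>="\<lambda>_. rest_level"])
       (use False cost_so_less_uso rate_sum_rest_level in \<open>auto simp: rate_sum_def\<close>)
next
  case True
  define E where "E = exp (- rate_sum * tau m)"
  have E: "0 < E" "E < 1" using rate_sum_pos tau_pos by (auto simp: E_def)
  have E_inv: "E * exp (rate_sum * tau m) = 1" by (simp add: E_def exp_add[symmetric])
  define q where "q = 1 - (1 - pr m) * E"
  have "(1 - pr m) * E < 1 * 1" using E pr_pos pr_less_1 by (intro mult_strict_mono) auto
  then have q: "0 < q" by (simp add: q_def)
  \<comment> \<open>the solution of \<open>z = \<Delta> (tau m)\<close> for the trajectory that starts at \<open>cost_so m + (1 - pr m) * z\<close>\<close>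
  define z where "z = (rest_level * (1 - E) + cost_so m * E) / q"
  define y where "y = cost_so m + (1 - pr m) * z"
  have z: "z * q = rest_level * (1 - E) + cost_so m * E" using q by (simp add: z_def)
  have "(pr m * z - cost_so m) * q = pr m * (z * q) - cost_so m * q" by (simp add: algebra_simps)
  also have "\<dots> = (pr m * rest_level - cost_so m) * (1 - E)" unfolding z by (simp add: q_def algebra_simps)
  finally have "0 \<le> (pr m * z - cost_so m) * q" using True E by simp
  then have so: "cost_so m \<le> pr m * z" using q by (simp add: zero_le_mult_iff)
  have "(cost_uso m - pr m * z) * q = cost_uso m * q - pr m * (z * q)" by (simp add: algebra_simps)
  also have "\<dots> = pr m * (break_even * (1 - E) + cost_uso m * E - rest_level * (1 - E) - cost_so m * E)"
    unfolding z by (simp add: q_def pr_break_even[symmetric] algebra_simps)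
  also have "\<dots> = pr m * (E * (cost_uso m - cost_so m) - (rest_level - break_even) * (E * exp (rate_sum * tau m) - E))"
    unfolding E_inv by (simp add: algebra_simps)
  also have "\<dots> = pr m * E * (cost_uso m - cost_so m - (rest_level - break_even) * (exp (rate_sum * tau m) - 1))"
    by (simp add: algebra_simps)
  also have "\<dots> \<ge> 0" using assms pr_pos E by (simp add: uso_profitable_def)
  finally have uso: "pr m * z \<le> cost_uso m" using q by (simp add: zero_le_mult_iff)
  have "(rest_level - z) * q = rest_level * q - z * q" by (simp add: algebra_simps)
  also have "\<dots> = E * (pr m * rest_level - cost_so m)" unfolding z by (simp add: q_def algebra_simps)
  finally have "0 \<le> (rest_level - z) * q" using True E by simp
  then have "z \<le> rest_level" using q by (simp add: zero_le_mult_iff)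
  then have "(1 - pr m) * z \<le> (1 - pr m) * rest_level" using pr_less_1 by (intro mult_left_mono) auto
  then have y: "y \<le> rest_level" using True unfolding y_def by (simp add: algebra_simps)
  define \<Delta> where "\<Delta> t = rest_level + (y - rest_level) * exp (- rate_sum * t)" for t
  have \<Delta>_tau: "\<Delta> (tau m) = z"
  proof -
    have "\<Delta> (tau m) = rest_level + (y - rest_level) * E" by (simp add: \<Delta>_def E_def)
    then show ?thesis using z by (simp add: y_def q_def algebra_simps)
  qed
  have \<Delta>_le: "\<Delta> t \<le> z" if "t < tau m" for t
  proof -
    have "exp (- rate_sum * tau m) \<le> exp (- rate_sum * t)" using that rate_sum_pos by simp
    then have "(y - rest_level) * exp (- rate_sum * t) \<le> (y - rest_level) * exp (- rate_sum * tau m)"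
      using y by (intro mult_left_mono_neg) auto
    then show ?thesis using \<Delta>_tau by (simp add: \<Delta>_def)
  qed
  have \<Delta>_uso: "pr m * \<Delta> t \<le> cost_uso m" if "t < tau m" for t
    using mult_left_mono[OF \<Delta>_le[OF that] pr_nonneg] uso by linarith
  show ?thesis
  proof (rule optimal_pm_policy[where \<Delta>=\<Delta>])
    show "continuous_on {0..tau m} \<Delta>" unfolding \<Delta>_def by (intro continuous_intros)
    show "(\<Delta> has_real_derivative mu1 m * cost_cm m - (mu1 m + mu2 m) * \<Delta> t
        + uso_rate m * min 0 (cost_uso m - pr m * \<Delta> t)) (at t)" if "0 < t" "t < tau m" for t
    proof -
      have "(\<Delta> has_real_derivative (y - rest_level) * (exp (- rate_sum * t) * - rate_sum)) (at t)"
        unfolding \<Delta>_def[abs_def] by (auto intro!: derivative_eq_intros)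
      then show ?thesis
        by (rule DERIV_cong)
           (use \<Delta>_uso[OF that(2)] rate_sum_rest_level in \<open>simp add: \<Delta>_def rate_sum_def[symmetric] min_def algebra_simps\<close>)
    qed
    show "\<Delta> 0 = \<Delta> (tau m) + min 0 (cost_so m - pr m * \<Delta> (tau m))"
      using so by (simp add: \<Delta>_tau) (simp add: \<Delta>_def y_def algebra_simps)
  qed (use True so \<Delta>_tau \<Delta>_uso in auto)
qed

text \<open>If the crossing time \<open>s\<close> is positive, two exponentials glued at \<open>s\<close> form the solution. If it
  is not, \<open>\<Delta>\<close> stays above \<open>break_even\<close> throughout and starts at the value \<open>y\<close> that the
  boundary condition determines; \<open>so_gap 0 \<le> 0\<close> is what makes \<open>y\<close> at least \<open>break_even\<close>.\<close>
lemma optimal_with_uso: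
  assumes "break_even < rest_level" and s: "so_gap s = 0" "s < tau m"
  shows "optimal m (pm_policy True {max 0 s..<tau m})"
proof -
  have break_even_less_pm: "break_even < pm_level" by (rule break_even_less_pm_level[OF assms(1)])
  have pA: "cost_uso m < pr m * pm_level" using mult_strict_left_mono[OF break_even_less_pm pr_pos] pr_break_even by simp
  have uso_pm: "cost_uso m \<le> pr m * x" if "break_even \<le> x" for x
    using mult_left_mono[OF that pr_nonneg] pr_break_even by simp
  have no_uso_pm: "pr m * x \<le> cost_uso m" if "x \<le> break_even" for x
    using mult_left_mono[OF that pr_nonneg] pr_break_even by simp
  show ?thesis
  proof (cases "0 < s")
    case False
    define E where "E = exp (- pm_rate * tau m)"
    have E: "0 < E" "E < 1" using pm_rate_pos tau_pos by (auto simp: E_def)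
    define q where "q = 1 - (1 - pr m) * E"
    have "(1 - pr m) * E < 1 * 1" using E pr_pos pr_less_1 by (intro mult_strict_mono) auto
    then have q: "0 < q" by (simp add: q_def)
    \<comment> \<open>the solution of \<open>y = cost_so m + (1 - pr m) * \<Delta> (tau m)\<close>\<close>
    define y where "y = (cost_so m + (1 - pr m) * pm_level * (1 - E)) / q"
    have y: "y * q = cost_so m + (1 - pr m) * pm_level * (1 - E)" using q by (simp add: y_def)
    have "so_gap 0 \<le> 0"
      using so_gap_decreasing[OF assms(1), of s 0] s False tau_pos by (cases "s = 0") auto
    moreover have "(y - break_even) * q = - so_gap 0"
      using y by (simp add: so_gap_def q_def E_def algebra_simps)
    ultimately have "0 \<le> (y - break_even) * q" by simp
    then have y_ge: "break_even \<le> y" using q by (simp add: zero_le_mult_iff)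
    have "(pm_level - y) * q = pr m * pm_level - cost_so m" using y by (simp add: q_def algebra_simps)
    then have "0 \<le> (pm_level - y) * q" using pA cost_so_less_uso by simp
    then have y_le: "y \<le> pm_level" using q by (simp add: zero_le_mult_iff)
    define \<Delta> where "\<Delta> t = pm_level + (y - pm_level) * exp (- pm_rate * t)" for t
    have \<Delta>_ge: "break_even \<le> \<Delta> t" if "0 \<le> t" for t
    proof -
      have "exp (- pm_rate * t) \<le> 1" using that pm_rate_pos by simp
      then have "(y - pm_level) * 1 \<le> (y - pm_level) * exp (- pm_rate * t)"
        using y_le by (intro mult_left_mono_neg) auto
      then show ?thesis using y_ge by (simp add: \<Delta>_def)
    qed
    have so: "cost_so m \<le> pr m * \<Delta> (tau m)"
      using uso_pm[OF \<Delta>_ge[of "tau m"]] tau_pos cost_so_less_uso by simp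
    show ?thesis
    proof (rule optimal_pm_policy[where \<Delta>=\<Delta>])
      show "continuous_on {0..tau m} \<Delta>" unfolding \<Delta>_def by (intro continuous_intros)
      show "(\<Delta> has_real_derivative mu1 m * cost_cm m - (mu1 m + mu2 m) * \<Delta> t
          + uso_rate m * min 0 (cost_uso m - pr m * \<Delta> t)) (at t)" if "0 < t" "t < tau m" for t
      proof -
        have "(\<Delta> has_real_derivative (y - pm_level) * (exp (- pm_rate * t) * - pm_rate)) (at t)"
          unfolding \<Delta>_def[abs_def] by (auto intro!: derivative_eq_intros)
        moreover have "(y - pm_level) * (exp (- pm_rate * t) * - pm_rate) = pm_rate * pm_level - pm_rate * \<Delta> t"
          by (simp add: \<Delta>_def algebra_simps)
        moreover have "min 0 (cost_uso m - pr m * \<Delta> t) = cost_uso m - pr m * \<Delta> t"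
          using uso_pm[OF \<Delta>_ge[of t]] that by simp
        moreover have "pm_rate * pm_level - pm_rate * \<Delta> t = mu1 m * cost_cm m - (mu1 m + mu2 m) * \<Delta> t
            + uso_rate m * (cost_uso m - pr m * \<Delta> t)"
          using pm_rate_pm_level by (simp add: pm_rate_def rate_sum_def algebra_simps)
        ultimately show ?thesis by simp
      qed
      have "\<Delta> 0 = cost_so m + (1 - pr m) * \<Delta> (tau m)"
        using y by (simp add: \<Delta>_def q_def E_def algebra_simps)
      then show "\<Delta> 0 = \<Delta> (tau m) + min 0 (cost_so m - pr m * \<Delta> (tau m))"
        using so by (simp add: algebra_simps)
    qed (use so uso_pm \<Delta>_ge False in auto)
  next
    case True
    define \<Delta>1 where "\<Delta>1 t = rest_level - (rest_level - break_even) * exp (rate_sum * (s - t))" for t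
    define \<Delta>2 where "\<Delta>2 t = pm_level - (pm_level - break_even) * exp (pm_rate * (s - t))" for t
    define \<Delta> where "\<Delta> t = (if t \<in> {..s} then \<Delta>1 t else \<Delta>2 t)" for t
    have \<Delta>1: "\<Delta>1 t \<le> break_even" if "t \<le> s" for t
    proof -
      have "1 \<le> exp (rate_sum * (s - t))" using that rate_sum_pos by simp
      then have "(rest_level - break_even) * 1 \<le> (rest_level - break_even) * exp (rate_sum * (s - t))" using assms(1) by (intro mult_left_mono) auto
      then show ?thesis by (simp add: \<Delta>1_def)
    qed
    have \<Delta>2: "break_even \<le> \<Delta>2 t" if "s \<le> t" for t
    proof -
      have "exp (pm_rate * (s - t)) \<le> 1" using that pm_rate_pos by (simp add: mult_le_0_iff)
      then have "(pm_level - break_even) * exp (pm_rate * (s - t)) \<le> (pm_level - break_even) * 1" using break_even_less_pm by (intro mult_left_mono) auto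
      then show ?thesis by (simp add: \<Delta>2_def)
    qed
    define rhs where "rhs x = mu1 m * cost_cm m - (mu1 m + mu2 m) * x
        + uso_rate m * min 0 (cost_uso m - pr m * x)" for x
    have d1: "(\<Delta>1 has_vector_derivative rhs (\<Delta>1 t)) (at t within X)" if "t \<le> s" for t X
    proof -
      have "(\<Delta>1 has_real_derivative - ((rest_level - break_even) * (exp (rate_sum * (s - t)) * - rate_sum))) (at t within X)"
        unfolding \<Delta>1_def[abs_def] by (auto intro!: derivative_eq_intros)
      moreover have "- ((rest_level - break_even) * (exp (rate_sum * (s - t)) * - rate_sum)) = rate_sum * rest_level - rate_sum * \<Delta>1 t"
        by (simp add: \<Delta>1_def algebra_simps)
      moreover have "min 0 (cost_uso m - pr m * \<Delta>1 t) = 0"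
        using no_uso_pm[OF \<Delta>1[OF that]] by simp
      ultimately show ?thesis
        unfolding rhs_def rate_sum_rest_level has_real_derivative_iff_has_vector_derivative by (simp add: rate_sum_def)
    qed
    have d2: "(\<Delta>2 has_vector_derivative rhs (\<Delta>2 t)) (at t within X)" if "s \<le> t" for t X
    proof -
      have "(\<Delta>2 has_real_derivative - ((pm_level - break_even) * (exp (pm_rate * (s - t)) * - pm_rate))) (at t within X)"
        unfolding \<Delta>2_def[abs_def] by (auto intro!: derivative_eq_intros)
      moreover have "- ((pm_level - break_even) * (exp (pm_rate * (s - t)) * - pm_rate)) = pm_rate * pm_level - pm_rate * \<Delta>2 t"
        by (simp add: \<Delta>2_def algebra_simps)
      moreover have "min 0 (cost_uso m - pr m * \<Delta>2 t) = cost_uso m - pr m * \<Delta>2 t"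
        using uso_pm[OF \<Delta>2[OF that]] by simp
      moreover have "pm_rate * pm_level - pm_rate * \<Delta>2 t = mu1 m * cost_cm m - (mu1 m + mu2 m) * \<Delta>2 t
          + uso_rate m * (cost_uso m - pr m * \<Delta>2 t)"
        using pm_rate_pm_level by (simp add: pm_rate_def rate_sum_def algebra_simps)
      ultimately show ?thesis
        unfolding rhs_def has_real_derivative_iff_has_vector_derivative by simp
    qed
    have glue: "\<Delta>1 s = \<Delta>2 s" by (simp add: \<Delta>1_def \<Delta>2_def)
    have d: "(\<Delta> has_real_derivative rhs (\<Delta> t)) (at t)" for t
    proof -
      have "(\<Delta> has_vector_derivative (if t \<in> {..s} then rhs (\<Delta>1 t) else rhs (\<Delta>2 t))) (at t within UNIV)"
        unfolding \<Delta>_def[abs_def]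
        by (rule has_vector_derivative_If_within_closures[where T="{s<..}"])
           (use glue in \<open>auto intro!: d1 d2\<close>)
      then show ?thesis
        by (simp add: has_real_derivative_iff_has_vector_derivative \<Delta>_def split: if_splits)
    qed
    have \<Delta>_tau: "\<Delta> (tau m) = \<Delta>2 (tau m)" using s by (simp add: \<Delta>_def)
    have so: "cost_so m \<le> pr m * \<Delta> (tau m)"
      unfolding \<Delta>_tau using uso_pm[OF \<Delta>2[of "tau m"]] s cost_so_less_uso by simp
    show ?thesis
    proof (rule optimal_pm_policy[where \<Delta>=\<Delta>])
      show "continuous_on {0..tau m} \<Delta>"
        by (rule DERIV_continuous_on) (rule has_field_derivative_at_within[OF d])
      show "(\<Delta> has_real_derivative mu1 m * cost_cm m - (mu1 m + mu2 m) * \<Delta> t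
          + uso_rate m * min 0 (cost_uso m - pr m * \<Delta> t)) (at t)" for t
        using d[of t] unfolding rhs_def .
      have "\<Delta> 0 = \<Delta>1 0" using True by (simp add: \<Delta>_def)
      also have "\<dots> = cost_so m + (1 - pr m) * \<Delta> (tau m)"
        unfolding \<Delta>_tau using s(1) by (simp add: \<Delta>1_def \<Delta>2_def so_gap_def algebra_simps)
      finally show "\<Delta> 0 = \<Delta> (tau m) + min 0 (cost_so m - pr m * \<Delta> (tau m))"
        using so by (simp add: algebra_simps)
      show "cost_uso m \<le> pr m * \<Delta> t" if "t \<in> {max 0 s..<tau m}" for t
        using uso_pm[OF \<Delta>2[of t]] that glue by (cases "t = s") (auto simp: \<Delta>_def)
      show "pr m * \<Delta> t \<le> cost_uso m" if "0 < t" "t < tau m" "t \<notin> {max 0 s..<tau m}" for t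
        using no_uso_pm[OF \<Delta>1[of t]] that by (auto simp: \<Delta>_def)
    qed (use so in auto)
  qed
qed

lemma threshold_equation_iff:
  "cost_uso m / pr m = pm_level
    + ((- cost_so m + rest_level + (cost_uso m / pr m - rest_level) * exp (rate_sum * t)) / (1 - pr m) - pm_level)
      * exp (pm_rate * (tau m - t)) \<longleftrightarrow> so_gap t = 0"
proof -
  define e where "e = exp (pm_rate * (t - tau m))"
  define Y where "Y = - cost_so m + rest_level + (break_even - rest_level) * exp (rate_sum * t)"
  have e: "0 < e" by (simp add: e_def)
  have inv: "exp (pm_rate * (tau m - t)) = 1 / e"
    unfolding e_def by (simp add: exp_minus[symmetric] inverse_eq_divide[symmetric] algebra_simps)
  have "break_even = pm_level + (Y / (1 - pr m) - pm_level) * (1 / e)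
      \<longleftrightarrow> Y - (1 - pr m) * pm_level - (1 - pr m) * (break_even - pm_level) * e = 0"
    using e pr_less_1 by (simp add: field_simps) (auto simp: algebra_simps)
  also have "Y - (1 - pr m) * pm_level - (1 - pr m) * (break_even - pm_level) * e = so_gap t"
    by (simp add: so_gap_def Y_def e_def algebra_simps)
  finally show ?thesis unfolding inv Y_def break_even_def .
qed

lemma so_profitable_iff:
  "(mu1 m + mu2 m) * (cost_so m / pr m) < mu1 m * cost_cm m \<longleftrightarrow> cost_so m < pr m * rest_level"
proof -
  have "(mu1 m + mu2 m) * (cost_so m / pr m) < mu1 m * cost_cm m
      \<longleftrightarrow> rate_sum * (cost_so m / pr m) < rate_sum * rest_level"
    unfolding rate_sum_rest_level by (simp add: rate_sum_def)
  also have "\<dots> \<longleftrightarrow> cost_so m < pr m * rest_level" using rate_sum_pos pr_pos by (simp add: field_simps)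
  finally show ?thesis .
qed

lemma uso_condition_if_profitable:
  assumes uso_profitable
  shows "(cost_uso m / pr m - (cost_uso m - cost_so m) / (exp ((mu1 m + mu2 m) * tau m) - 1)) * (mu1 m + mu2 m)
    < mu1 m * cost_cm m"
proof -
  have "0 \<le> (cost_uso m - cost_so m) / (exp (rate_sum * tau m) - 1)"
    using cost_so_less_uso exp_rate_sum_tau by simp
  then have "break_even - (cost_uso m - cost_so m) / (exp (rate_sum * tau m) - 1) < rest_level"
    using break_even_less_rest_if_profitable[OF assms] by linarith
  then have "(break_even - (cost_uso m - cost_so m) / (exp (rate_sum * tau m) - 1)) * rate_sum < rate_sum * rest_level"
    using rate_sum_pos by (simp add: mult.commute)
  then show ?thesis unfolding rate_sum_rest_level by (simp add: rate_sum_def break_even_def)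
qed

end

theorem theorem1:
  fixes \<mu>\<^sub>1 \<mu>\<^sub>2 lam \<tau> p c_pm_so c_pm_uso c_cm :: real
    and m :: model and so_pm uso_pm :: bool and threshold_eq :: "real \<Rightarrow> bool"
  assumes "0 < \<mu>\<^sub>1" "0 < \<mu>\<^sub>2" "0 < lam" "0 < \<tau>"
    and "0 < c_pm_so" "c_pm_so < c_pm_uso" "c_pm_uso < c_cm"
    and "0 < p" "p < 1"
  defines "m \<equiv> \<lparr>mu1 = \<mu>\<^sub>1, mu2 = \<mu>\<^sub>2, uso_rate = lam, tau = \<tau>, pr = p,
                 cost_so = c_pm_so, cost_uso = c_pm_uso, cost_cm = c_cm\<rparr>"
  defines "so_pm \<equiv> \<mu>\<^sub>1 * c_cm > (\<mu>\<^sub>1 + \<mu>\<^sub>2) * (c_pm_so / p)"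
  defines "uso_pm \<equiv> \<mu>\<^sub>1 * c_cm >
      (c_pm_uso / p - (c_pm_uso - c_pm_so) / (exp ((\<mu>\<^sub>1 + \<mu>\<^sub>2) * \<tau>) - 1)) * (\<mu>\<^sub>1 + \<mu>\<^sub>2)"
  defines "threshold_eq \<equiv> \<lambda>t.
      c_pm_uso / p =
        (\<mu>\<^sub>1 * c_cm + lam * c_pm_uso) / (\<mu>\<^sub>1 + \<mu>\<^sub>2 + lam * p)
        + ((- c_pm_so + \<mu>\<^sub>1 * c_cm / (\<mu>\<^sub>1 + \<mu>\<^sub>2)
             + (c_pm_uso / p - \<mu>\<^sub>1 * c_cm / (\<mu>\<^sub>1 + \<mu>\<^sub>2)) * exp ((\<mu>\<^sub>1 + \<mu>\<^sub>2) * t)) / (1 - p)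
           - (\<mu>\<^sub>1 * c_cm + lam * c_pm_uso) / (\<mu>\<^sub>1 + \<mu>\<^sub>2 + lam * p))
          * exp ((\<mu>\<^sub>1 + \<mu>\<^sub>2 + lam * p) * (\<tau> - t))"
  shows "(\<not> uso_pm \<longrightarrow> optimal m (pm_policy so_pm {}))
       \<and> (uso_pm \<and> (\<exists>t. threshold_eq t) \<longrightarrow>
            (\<exists>t. threshold_eq t \<and> optimal m (pm_policy so_pm {min \<tau> (max 0 t)..<\<tau>})))
       \<and> (uso_pm \<and> (\<nexists>t. threshold_eq t) \<longrightarrow> optimal m (pm_policy so_pm {}))"
proof -
  have m_simps: "mu1 m = \<mu>\<^sub>1" "mu2 m = \<mu>\<^sub>2" "uso_rate m = lam" "tau m = \<tau>" "pr m = p"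
    "cost_so m = c_pm_so" "cost_uso m = c_pm_uso" "cost_cm m = c_cm"
    by (simp_all add: m_def)
  interpret imperfect_maintenance m
    by unfold_locales (use assms(1-9) in \<open>simp_all add: m_simps\<close>)
  have so: "so_pm \<longleftrightarrow> cost_so m < pr m * rest_level"
    using so_profitable_iff by (simp add: so_pm_def m_simps)
  have uso: "uso_pm" if uso_profitable
    using uso_condition_if_profitable[OF that] by (simp add: uso_pm_def m_simps)
  have threshold: "threshold_eq t \<longleftrightarrow> so_gap t = 0" for t
    using threshold_equation_iff[of t] by (simp add: threshold_eq_def pm_level_def rest_level_def pm_rate_def rate_sum_def m_simps)
  show ?thesis
  proof (cases uso_profitable)
    case True
    have break_even_less_rest: "break_even < rest_level" by (rule break_even_less_rest_if_profitable[OF True])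
    have so_pm
      using mult_strict_left_mono[OF break_even_less_rest pr_pos] pr_break_even cost_so_less_uso by (simp add: so)
    obtain s where s: "s < tau m" "so_gap s = 0" using ex_so_gap_root[OF True] by auto
    have "min \<tau> (max 0 s) = max 0 s" using s(1) \<open>0 < \<tau>\<close> by (simp add: m_simps)
    then have "optimal m (pm_policy so_pm {min \<tau> (max 0 s)..<\<tau>})"
      using optimal_with_uso[OF break_even_less_rest s(2,1)] \<open>so_pm\<close> by (simp add: m_simps)
    moreover have "threshold_eq s" using s(2) by (simp only: threshold)
    ultimately show ?thesis using uso[OF True] by blast
  next
    case False
    have none: "optimal m (pm_policy so_pm {})"
      using optimal_without_uso[OF False] by (simp add: so)
    have "\<exists>t. threshold_eq t \<and> optimal m (pm_policy so_pm {min \<tau> (max 0 t)..<\<tau>})" if "threshold_eq r" for r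
    proof -
      have "so_gap r = 0" using that by (simp only: threshold)
      then obtain t where t: "tau m \<le> t" "so_gap t = 0"
        using so_gap_root_after_tau[OF False] by blast
      then have "{min \<tau> (max 0 t)..<\<tau>} = {}" by (simp add: m_simps)
      then have "optimal m (pm_policy so_pm {min \<tau> (max 0 t)..<\<tau>})" using none by simp
      moreover have "threshold_eq t" using t(2) by (simp only: threshold)
      ultimately show ?thesis by blast
    qed
    then show ?thesis using none by blast
  qed
qed

end
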